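(* Let $\mathcal{A}$ be an abelian category and $\mathcal{W}$ a subcategory of $\mathcal{A}$. If $\mathcal{W}\perp\mathcal{W}$, then $\mathcal{G}^n(\mathcal{W})=\mathcal{G}(\mathcal{W})$ for each $n\geq 1$.
   Context: "Subcategory" means full additive subcategory closed under isomorphisms. $\mathcal{X}\perp\mathcal{Y}$ means $\operatorname{Ext}^{i}_{\mathcal{A}}(X,Y)=0$ for all $i\geq 1$ and all objects $X\in\mathcal{X}$, $Y\in\mathcal{Y}$. For a subcategory $\mathcal{X}$, an exact complex $X=\cdots\to X_1\xrightarrow{\partial^X_1}X_0\xrightarrow{\partial^X_0}X_{-1}\to\cdots$ of objects in $\mathcal{X}$ is totally $\mathcal{X}$-acyclic if $\operatorname{Hom}_{\mathcal{A}}(X',X)$ and $\operatorname{Hom}_{\mathcal{A}}(X,X')$ are exact for every object $X'$ in $\mathcal{X}$. $\mathcal{G}(\mathcal{X})$ is the subcategory of objects $M\cong\operatorname{Coker}(\partial^X_1)$ for some totally $\mathcal{X}$-acyclic complex $X$. Set $\mathcal{G}^0(\mathcal{X})=\mathcal{X}$, $\mathcal{G}^1(\mathcal{X})=\mathcal{G}(\mathcal{X})$, and inductively $\mathcal{G}^{n+1}(\mathcal{X})=\mathcal{G}(\mathcal{G}^n(\mathcal{X}))$ for $n\geq 1$. *)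

theory Defs
  imports "HOL-Algebra.Exact_Sequence"
begin

section \<open>Abelian categories\<close>

text \<open>
  The set of arrows is single-sorted: every arrow determines its domain and its codomain.
  \<open>Comp g f\<close> (written \<open>g \<cdot> f\<close>) is ``first \<open>f\<close>, then \<open>g\<close>'', and is only
  constrained when \<open>Cod f = Dom g\<close>; the sum \<open>Plus f g\<close> is only constrained on parallel arrows.
\<close>

record ('o, 'm) preadditive_data =
  Obj :: "'o set"
  Arr :: "'m set"
  Dom :: "'m \<Rightarrow> 'o"
  Cod :: "'m \<Rightarrow> 'o"
  Ident :: "'o \<Rightarrow> 'm"
  Comp :: "'m \<Rightarrow> 'm \<Rightarrow> 'm" (infixr \<open>\<cdot>\<index>\<close> 75)
  Plus :: "'m \<Rightarrow> 'm \<Rightarrow> 'm" (infixl \<open>\<boxplus>\<index>\<close> 65)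
  Zero :: "'o \<Rightarrow> 'o \<Rightarrow> 'm"

definition arrows :: "('o, 'm, 'z) preadditive_data_scheme \<Rightarrow> 'o \<Rightarrow> 'o \<Rightarrow> 'm set" where
  "arrows A X Y = {f \<in> Arr A. Dom A f = X \<and> Cod A f = Y}"

text \<open>The additive group \<open>Hom(X, Y)\<close>, as a \<open>monoid\<close> record, hence in multiplicative notation.\<close>

definition Hom :: "('o, 'm, 'z) preadditive_data_scheme \<Rightarrow> 'o \<Rightarrow> 'o \<Rightarrow> 'm monoid" where
  "Hom A X Y = \<lparr>carrier = arrows A X Y, mult = Plus A, one = Zero A X Y\<rparr>"

locale category =
  fixes A :: "('o, 'm, 'z) preadditive_data_scheme" (structure)
  assumes Dom_Obj: "f \<in> Arr A \<Longrightarrow> Dom A f \<in> Obj A"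
    and Cod_Obj: "f \<in> Arr A \<Longrightarrow> Cod A f \<in> Obj A"
    and Ident_arrows: "X \<in> Obj A \<Longrightarrow> Ident A X \<in> arrows A X X"
    and Comp_arrows: "\<lbrakk>f \<in> arrows A X Y; g \<in> arrows A Y Z\<rbrakk> \<Longrightarrow> g \<cdot> f \<in> arrows A X Z"
    and Comp_Ident_right: "f \<in> arrows A X Y \<Longrightarrow> f \<cdot> Ident A X = f"
    and Comp_Ident_left: "f \<in> arrows A X Y \<Longrightarrow> Ident A Y \<cdot> f = f"
    and Comp_assoc: "\<lbrakk>f \<in> arrows A W X; g \<in> arrows A X Y; h \<in> arrows A Y Z\<rbrakk>
        \<Longrightarrow> (h \<cdot> g) \<cdot> f = h \<cdot> (g \<cdot> f)"

locale preadditive_category = category +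
  assumes Hom_comm_group: "\<lbrakk>X \<in> Obj A; Y \<in> Obj A\<rbrakk> \<Longrightarrow> comm_group (Hom A X Y)"
    and Comp_Plus_right: "\<lbrakk>f \<in> arrows A X Y; f' \<in> arrows A X Y; g \<in> arrows A Y Z\<rbrakk>
        \<Longrightarrow> g \<cdot> (f \<boxplus> f') = g \<cdot> f \<boxplus> g \<cdot> f'"
    and Comp_Plus_left: "\<lbrakk>f \<in> arrows A X Y; g \<in> arrows A Y Z; g' \<in> arrows A Y Z\<rbrakk>
        \<Longrightarrow> (g \<boxplus> g') \<cdot> f = g \<cdot> f \<boxplus> g' \<cdot> f"

definition zero_object :: "('o, 'm, 'z) preadditive_data_scheme \<Rightarrow> 'o \<Rightarrow> bool" where
  "zero_object A Z \<longleftrightarrow> Z \<in> Obj A \<and>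
     (\<forall>X\<in>Obj A. (\<exists>!f. f \<in> arrows A X Z) \<and> (\<exists>!f. f \<in> arrows A Z X))"

definition isomorphic :: "('o, 'm, 'z) preadditive_data_scheme \<Rightarrow> 'o \<Rightarrow> 'o \<Rightarrow> bool" where
  "isomorphic A X Y \<longleftrightarrow>
     (\<exists>f\<in>arrows A X Y. \<exists>g\<in>arrows A Y X. g \<cdot>\<^bsub>A\<^esub> f = Ident A X \<and> f \<cdot>\<^bsub>A\<^esub> g = Ident A Y)"

text \<open>\<open>S\<close> is a direct sum of \<open>X\<close> and \<open>Y\<close>, i.e.\ carries the structure of a biproduct.\<close>

definition direct_sum :: "('o, 'm, 'z) preadditive_data_scheme \<Rightarrow> 'o \<Rightarrow> 'o \<Rightarrow> 'o \<Rightarrow> bool" where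
  "direct_sum A X Y S \<longleftrightarrow>
     (\<exists>i\<in>arrows A X S. \<exists>j\<in>arrows A Y S. \<exists>p\<in>arrows A S X. \<exists>q\<in>arrows A S Y.
        p \<cdot>\<^bsub>A\<^esub> i = Ident A X \<and> q \<cdot>\<^bsub>A\<^esub> j = Ident A Y \<and>
        p \<cdot>\<^bsub>A\<^esub> j = Zero A Y X \<and> q \<cdot>\<^bsub>A\<^esub> i = Zero A X Y \<and>
        (i \<cdot>\<^bsub>A\<^esub> p) \<boxplus>\<^bsub>A\<^esub> (j \<cdot>\<^bsub>A\<^esub> q) = Ident A S)"

definition monic :: "('o, 'm, 'z) preadditive_data_scheme \<Rightarrow> 'm \<Rightarrow> bool" where
  "monic A f \<longleftrightarrow> f \<in> Arr A \<and>
     (\<forall>W. \<forall>g\<in>arrows A W (Dom A f). \<forall>h\<in>arrows A W (Dom A f). f \<cdot>\<^bsub>A\<^esub> g = f \<cdot>\<^bsub>A\<^esub> h \<longrightarrow> g = h)"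

definition epic :: "('o, 'm, 'z) preadditive_data_scheme \<Rightarrow> 'm \<Rightarrow> bool" where
  "epic A f \<longleftrightarrow> f \<in> Arr A \<and>
     (\<forall>W. \<forall>g\<in>arrows A (Cod A f) W. \<forall>h\<in>arrows A (Cod A f) W. g \<cdot>\<^bsub>A\<^esub> f = h \<cdot>\<^bsub>A\<^esub> f \<longrightarrow> g = h)"

definition is_kernel :: "('o, 'm, 'z) preadditive_data_scheme \<Rightarrow> 'm \<Rightarrow> 'm \<Rightarrow> bool" where
  "is_kernel A f k \<longleftrightarrow> f \<in> Arr A \<and> k \<in> Arr A \<and> Cod A k = Dom A f \<and>
     f \<cdot>\<^bsub>A\<^esub> k = Zero A (Dom A k) (Cod A f) \<and>
     (\<forall>W. \<forall>x\<in>arrows A W (Dom A f). f \<cdot>\<^bsub>A\<^esub> x = Zero A W (Cod A f) \<longrightarrow>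
        (\<exists>!u. u \<in> arrows A W (Dom A k) \<and> k \<cdot>\<^bsub>A\<^esub> u = x))"

definition is_cokernel :: "('o, 'm, 'z) preadditive_data_scheme \<Rightarrow> 'm \<Rightarrow> 'm \<Rightarrow> bool" where
  "is_cokernel A f q \<longleftrightarrow> f \<in> Arr A \<and> q \<in> Arr A \<and> Dom A q = Cod A f \<and>
     q \<cdot>\<^bsub>A\<^esub> f = Zero A (Dom A f) (Cod A q) \<and>
     (\<forall>W. \<forall>x\<in>arrows A (Cod A f) W. x \<cdot>\<^bsub>A\<^esub> f = Zero A (Dom A f) W \<longrightarrow>
        (\<exists>!u. u \<in> arrows A (Cod A q) W \<and> u \<cdot>\<^bsub>A\<^esub> q = x))"

locale abelian_category = preadditive_category +
  assumes has_zero_object: "\<exists>Z. zero_object A Z"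
    and has_direct_sums: "\<lbrakk>X \<in> Obj A; Y \<in> Obj A\<rbrakk> \<Longrightarrow> \<exists>S. direct_sum A X Y S"
    and has_kernels: "f \<in> Arr A \<Longrightarrow> \<exists>k. is_kernel A f k"
    and has_cokernels: "f \<in> Arr A \<Longrightarrow> \<exists>q. is_cokernel A f q"
    and monic_is_kernel: "monic A k \<Longrightarrow> \<exists>f. is_kernel A f k"
    and epic_is_cokernel: "epic A q \<Longrightarrow> \<exists>f. is_cokernel A f q"

text \<open>The image of \<open>f\<close> is the kernel of its cokernel.\<close>

definition is_image :: "('o, 'm, 'z) preadditive_data_scheme \<Rightarrow> 'm \<Rightarrow> 'm \<Rightarrow> bool" where
  "is_image A f k \<longleftrightarrow> (\<exists>q. is_cokernel A f q \<and> is_kernel A q k)"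

text \<open>
  Exactness of \<open>\<cdot> \<rightarrow> \<cdot> \<rightarrow> \<cdot>\<close> (first \<open>f\<close>, then \<open>g\<close>) in the middle: the image of \<open>f\<close> and the
  kernel of \<open>g\<close> are the same subobject, i.e.\ are represented by a common monomorphism.
\<close>

definition exact_pair :: "('o, 'm, 'z) preadditive_data_scheme \<Rightarrow> 'm \<Rightarrow> 'm \<Rightarrow> bool" where
  "exact_pair A f g \<longleftrightarrow> (\<exists>k. is_image A f k \<and> is_kernel A g k)"


section \<open>Subcategories and Ext\<close>

text \<open>
  A full additive subcategory closed under isomorphisms, given by its set of objects.  (Fullness
  makes zero objects and direct sums in the subcategory the same as in the ambient category.)
\<close>

definition subcategory :: "('o, 'm, 'z) preadditive_data_scheme \<Rightarrow> 'o set \<Rightarrow> bool" where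
  "subcategory A W \<longleftrightarrow> W \<subseteq> Obj A \<and>
     (\<exists>Z\<in>W. zero_object A Z) \<and>
     (\<forall>X\<in>W. \<forall>Y\<in>W. \<exists>S\<in>W. direct_sum A X Y S) \<and>
     (\<forall>X\<in>W. \<forall>Y\<in>Obj A. isomorphic A X Y \<longrightarrow> Y \<in> W)"

text \<open>
  No projectives or injectives are assumed, so Ext is Yoneda's.  For \<open>n \<ge> 1\<close>, an \<open>n\<close>-extension
  \<open>0 \<rightarrow> Y \<rightarrow> E\<^sub>n \<rightarrow> \<dots> \<rightarrow> E\<^sub>1 \<rightarrow> X \<rightarrow> 0\<close> is given by the list of its \<open>n + 1\<close> nontrivial arrows, read from
  right to left: entry \<open>0\<close> is \<open>E\<^sub>1 \<rightarrow> X\<close> and entry \<open>n\<close> is \<open>Y \<rightarrow> E\<^sub>n\<close>.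
\<close>

definition extension ::
  "('o, 'm, 'z) preadditive_data_scheme \<Rightarrow> nat \<Rightarrow> 'o \<Rightarrow> 'o \<Rightarrow> 'm list \<Rightarrow> bool" where
  "extension A n X Y e \<longleftrightarrow> length e = n + 1 \<and> set e \<subseteq> Arr A \<and>
     Cod A (e ! 0) = X \<and> Dom A (e ! n) = Y \<and>
     epic A (e ! 0) \<and> monic A (e ! n) \<and>
     (\<forall>i<n. Dom A (e ! i) = Cod A (e ! Suc i) \<and> exact_pair A (e ! Suc i) (e ! i))"

text \<open>
  A morphism of \<open>n\<close>-extensions which is the identity on both ends; \<open>\<phi> i\<close> is the component at the
  codomain of the \<open>i\<close>-th arrow, and \<open>\<phi> (n + 1)\<close> the one at \<open>Y\<close>.
\<close>

definition extension_morphism ::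
  "('o, 'm, 'z) preadditive_data_scheme \<Rightarrow> nat \<Rightarrow> 'o \<Rightarrow> 'o \<Rightarrow> 'm list \<Rightarrow> 'm list \<Rightarrow> bool" where
  "extension_morphism A n X Y e e' \<longleftrightarrow> extension A n X Y e \<and> extension A n X Y e' \<and>
     (\<exists>\<phi>. \<phi> 0 = Ident A X \<and> \<phi> (n + 1) = Ident A Y \<and>
        (\<forall>i\<le>n. \<phi> i \<in> arrows A (Cod A (e ! i)) (Cod A (e' ! i)) \<and>
                \<phi> i \<cdot>\<^bsub>A\<^esub> (e ! i) = (e' ! i) \<cdot>\<^bsub>A\<^esub> \<phi> (Suc i)))"

definition Ext ::
  "('o, 'm, 'z) preadditive_data_scheme \<Rightarrow> nat \<Rightarrow> 'o \<Rightarrow> 'o \<Rightarrow> 'm list set set" where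
  "Ext A n X Y =
     {e. extension A n X Y e} // {(e, e'). equivclp (extension_morphism A n X Y) e e'}"

text \<open>
  The Yoneda group \<open>Ext\<^sup>n(X, Y)\<close> is zero iff its underlying set is a singleton, so its
  addition (the Baer sum) is not needed here.
\<close>

definition Ext_orthogonal ::
  "('o, 'm, 'z) preadditive_data_scheme \<Rightarrow> 'o set \<Rightarrow> 'o set \<Rightarrow> bool" where
  "Ext_orthogonal A \<X> \<Y> \<longleftrightarrow> (\<forall>i\<ge>1. \<forall>X\<in>\<X>. \<forall>Y\<in>\<Y>. is_singleton (Ext A i X Y))"


section \<open>Gorenstein subcategories\<close>

text \<open>
  A complex \<open>\<dots> \<rightarrow> X\<^sub>1 \<rightarrow> X\<^sub>0 \<rightarrow> X\<^sub>-\<^sub>1 \<rightarrow> \<dots>\<close> is given by its differentials \<open>d n : X\<^sub>n \<rightarrow> X\<^sub>n\<^sub>-\<^sub>1\<close>, so that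
  \<open>X\<^sub>n = Dom A (d n)\<close>.  As exactness of \<open>Hom(X', X)\<close> and \<open>Hom(X, X')\<close> is exactness of complexes
  of abelian groups, \<open>exact_seq\<close> is used for it; its lists are read from right to left.
\<close>

definition exact_complex :: "('o, 'm, 'z) preadditive_data_scheme \<Rightarrow> (int \<Rightarrow> 'm) \<Rightarrow> bool" where
  "exact_complex A d \<longleftrightarrow>
     (\<forall>n. d n \<in> Arr A \<and> Cod A (d (n + 1)) = Dom A (d n) \<and> exact_pair A (d (n + 1)) (d n))"

definition Hom_into_exact ::
  "('o, 'm, 'z) preadditive_data_scheme \<Rightarrow> 'o \<Rightarrow> (int \<Rightarrow> 'm) \<Rightarrow> bool" where
  "Hom_into_exact A X' d \<longleftrightarrow>
     (\<forall>n. exact_seq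
        ([Hom A X' (Cod A (d n)), Hom A X' (Dom A (d n)), Hom A X' (Dom A (d (n + 1)))],
         [\<lambda>f. d n \<cdot>\<^bsub>A\<^esub> f, \<lambda>f. d (n + 1) \<cdot>\<^bsub>A\<^esub> f]))"

definition Hom_from_exact ::
  "('o, 'm, 'z) preadditive_data_scheme \<Rightarrow> (int \<Rightarrow> 'm) \<Rightarrow> 'o \<Rightarrow> bool" where
  "Hom_from_exact A d X' \<longleftrightarrow>
     (\<forall>n. exact_seq
        ([Hom A (Dom A (d (n + 1))) X', Hom A (Dom A (d n)) X', Hom A (Cod A (d n)) X'],
         [\<lambda>f. f \<cdot>\<^bsub>A\<^esub> d (n + 1), \<lambda>f. f \<cdot>\<^bsub>A\<^esub> d n]))"

definition totally_acyclic ::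
  "('o, 'm, 'z) preadditive_data_scheme \<Rightarrow> 'o set \<Rightarrow> (int \<Rightarrow> 'm) \<Rightarrow> bool" where
  "totally_acyclic A \<X> d \<longleftrightarrow> exact_complex A d \<and> (\<forall>n. Dom A (d n) \<in> \<X>) \<and>
     (\<forall>X'\<in>\<X>. Hom_into_exact A X' d \<and> Hom_from_exact A d X')"

definition Gorenstein :: "('o, 'm, 'z) preadditive_data_scheme \<Rightarrow> 'o set \<Rightarrow> 'o set" where
  "Gorenstein A \<X> =
     {M \<in> Obj A. \<exists>d q. totally_acyclic A \<X> d \<and> is_cokernel A (d 1) q \<and> isomorphic A M (Cod A q)}"

primrec Gorenstein_iter ::
  "('o, 'm, 'z) preadditive_data_scheme \<Rightarrow> nat \<Rightarrow> 'o set \<Rightarrow> 'o set" where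
  "Gorenstein_iter A 0 \<X> = \<X>"
| "Gorenstein_iter A (Suc n) \<X> = Gorenstein A (Gorenstein_iter A n \<X>)"

end

theory Submission
  imports Defs
begin

text \<open>
  Since \<open>W \<subseteq> \<G>(W)\<close>, everything rests on \<open>\<G>(\<G>(W)) \<subseteq> \<G>(W)\<close>; the equality for all \<open>n\<close> then
  follows by induction.

  Call a short exact sequence a conflation relative to \<open>\<X>\<close> if \<open>Hom(V, -)\<close> and \<open>Hom(-, V)\<close> keep it
  exact for all \<open>V\<close> in \<open>\<X>\<close>.  These form an exact structure in which the objects of \<open>\<X>\<close> are both
  projective and injective.  Cutting a totally acyclic complex into short exact sequences, and
  splicing such sequences together again, shows that \<open>\<G>(\<X>)\<close> is the largest class \<open>T\<close> such that
  every object \<open>N\<close> of \<open>T\<close> is the left end of a conflation and the right end of another one, each with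
  middle term in \<open>\<X>\<close> and the remaining end in \<open>T\<close> (\<open>Gorenstein_conflations\<close>,
  \<open>Gorenstein_coinduct\<close>).  This turns membership in \<open>\<G>(W)\<close> into a coinductive question: it suffices
  to put \<open>\<G>(\<G>(W))\<close> inside some class \<open>T\<close> with this closure property for \<open>W\<close>.

  The class that works is the closure \<open>T\<close> of \<open>\<G>(\<G>(W))\<close> under extensions by conflations relative
  to \<open>W\<close>.  For a generator \<open>M\<close> there are conflations \<open>M \<rightarrow> G \<rightarrow> M'\<close> with \<open>G\<close> in \<open>\<G>(W)\<close> and
  \<open>G \<rightarrow> V \<rightarrow> G'\<close> with \<open>V\<close> in \<open>W\<close>; the composite \<open>M \<rightarrow> V\<close> has a cokernel \<open>C\<close> that is an extension
  of \<open>G'\<close> by \<open>M'\<close> (\<open>conflation_composite\<close>), and so \<open>C\<close> lies in \<open>T\<close>.  For an extension of two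
  objects that embed in this way, \<open>horseshoe\<close> embeds the middle term into the direct sum, with a
  cokernel that is again an extension.  Only one of the two sides has to be treated: the class of
  extensions is self-dual, and the other side is the same statement in the opposite category.
\<close>

section \<open>Arithmetic of arrows\<close>

text \<open>
  The rules of a category are restated with explicit domains and codomains, so that the simplifier
  can discharge their typing conditions without guessing objects.
\<close>

lemma arrows_iff [simp]: "f \<in> arrows A X Y \<longleftrightarrow> f \<in> Arr A \<and> Dom A f = X \<and> Cod A f = Y"
  by (auto simp: arrows_def)

context preadditive_category
begin

declare Dom_Obj [simp] Cod_Obj [simp]

lemma Comp_typed [simp]:
  assumes "f \<in> Arr A" "g \<in> Arr A" "Cod A f = Dom A g"
  shows "g \<cdot> f \<in> Arr A" "Dom A (g \<cdot> f) = Dom A f" "Cod A (g \<cdot> f) = Cod A g"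
  using Comp_arrows[of f "Dom A f" "Dom A g" g "Cod A g"] assms by auto

lemma Ident_typed [simp]:
  assumes "X \<in> Obj A"
  shows "Ident A X \<in> Arr A" "Dom A (Ident A X) = X" "Cod A (Ident A X) = X"
  using Ident_arrows[OF assms] by auto

lemma Comp_assoc_typed [simp]:
  "\<lbrakk>f \<in> Arr A; g \<in> Arr A; h \<in> Arr A; Cod A f = Dom A g; Cod A g = Dom A h\<rbrakk>
    \<Longrightarrow> (h \<cdot> g) \<cdot> f = h \<cdot> (g \<cdot> f)"
  using Comp_assoc[of f "Dom A f" "Dom A g" g "Dom A h" h "Cod A h"] by auto

lemma Comp_Ident_typed [simp]:
  "\<lbrakk>f \<in> Arr A; Dom A f = X\<rbrakk> \<Longrightarrow> f \<cdot> Ident A X = f"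
  "\<lbrakk>f \<in> Arr A; Cod A f = Y\<rbrakk> \<Longrightarrow> Ident A Y \<cdot> f = f"
  using Comp_Ident_right Comp_Ident_left by auto

text \<open>
  Composites are kept associated to the right, where the left-hand side of a known equation between
  composites is no longer a subterm.  Instantiated with such an equation, the next two lemmas give
  rewrite rules that apply it in front of a further arrow.
\<close>
lemma Comp_square:
  assumes "g \<cdot> f = k \<cdot> h" "f \<in> Arr A" "g \<in> Arr A" "h \<in> Arr A" "k \<in> Arr A" "x \<in> Arr A"
    "Cod A f = Dom A g" "Cod A h = Dom A k" "Cod A x = Dom A f" "Cod A x = Dom A h"
  shows "g \<cdot> (f \<cdot> x) = k \<cdot> (h \<cdot> x)"
  using assms Comp_assoc_typed by metis

lemma Comp_triangle:
  assumes "g \<cdot> f = h" "f \<in> Arr A" "g \<in> Arr A" "x \<in> Arr A"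
    "Cod A f = Dom A g" "Cod A x = Dom A f"
  shows "g \<cdot> (f \<cdot> x) = h \<cdot> x"
  using assms Comp_assoc_typed by metis

lemma Hom_simps [simp]:
  "carrier (Hom A X Y) = arrows A X Y" "mult (Hom A X Y) = Plus A" "one (Hom A X Y) = Zero A X Y"
  by (auto simp: Hom_def)

lemma Zero_typed [simp]:
  assumes "X \<in> Obj A" "Y \<in> Obj A"
  shows "Zero A X Y \<in> Arr A" "Dom A (Zero A X Y) = X" "Cod A (Zero A X Y) = Y"
proof -
  interpret comm_group "Hom A X Y" using Hom_comm_group assms by blast
  show "Zero A X Y \<in> Arr A" "Dom A (Zero A X Y) = X" "Cod A (Zero A X Y) = Y"
    using one_closed by auto
qed

lemma Plus_typed [simp]:
  assumes "f \<in> Arr A" "g \<in> Arr A" "Dom A g = Dom A f" "Cod A g = Cod A f"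
  shows "f \<boxplus> g \<in> Arr A" "Dom A (f \<boxplus> g) = Dom A f" "Cod A (f \<boxplus> g) = Cod A f"
proof -
  interpret comm_group "Hom A (Dom A f) (Cod A f)" using Hom_comm_group assms by simp
  show "f \<boxplus> g \<in> Arr A" "Dom A (f \<boxplus> g) = Dom A f" "Cod A (f \<boxplus> g) = Cod A f"
    using m_closed[of f g] assms by auto
qed

lemma Plus_Zero [simp]:
  assumes "f \<in> Arr A" "Dom A f = X" "Cod A f = Y"
  shows "f \<boxplus> Zero A X Y = f" "Zero A X Y \<boxplus> f = f"
proof -
  interpret comm_group "Hom A X Y" using Hom_comm_group assms by auto
  show "f \<boxplus> Zero A X Y = f" "Zero A X Y \<boxplus> f = f"
    using r_one[of f] l_one[of f] assms by auto
qed

lemma Plus_cancel_Zero: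
  assumes "f \<boxplus> g = f" "f \<in> arrows A X Y" "g \<in> arrows A X Y"
  shows "g = Zero A X Y"
proof -
  interpret comm_group "Hom A X Y" using Hom_comm_group assms by auto
  show ?thesis using l_cancel_one[of f g] r_cancel_one[of f g] assms by auto
qed

text \<open>
  Subtraction of arrows enters in this form, where the difference is again an arrow to be studied:
  a lift or an extension found up to an error is corrected by a term that accounts for the error.
\<close>
lemma difference_exists:
  assumes "f \<in> arrows A X Y" "g \<in> arrows A X Y"
  obtains h where "h \<in> arrows A X Y" "f = g \<boxplus> h"
proof -
  interpret comm_group "Hom A X Y" using Hom_comm_group assms by auto
  have "inv\<^bsub>Hom A X Y\<^esub> g \<boxplus> f \<in> arrows A X Y" "f = g \<boxplus> (inv\<^bsub>Hom A X Y\<^esub> g \<boxplus> f)"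
    using assms m_assoc[of g "inv\<^bsub>Hom A X Y\<^esub> g" f] r_inv[of g] l_one[of f]
      m_closed[of "inv\<^bsub>Hom A X Y\<^esub> g" f] inv_closed[of g]
    by (auto simp del: arrows_iff)
  then show thesis using that by blast
qed

lemma Comp_Plus_typed [simp]:
  assumes "f \<in> Arr A" "f' \<in> Arr A" "Dom A f' = Dom A f" "Cod A f' = Cod A f"
  shows "\<lbrakk>g \<in> Arr A; Dom A g = Cod A f\<rbrakk> \<Longrightarrow> g \<cdot> (f \<boxplus> f') = g \<cdot> f \<boxplus> g \<cdot> f'"
    and "\<lbrakk>h \<in> Arr A; Cod A h = Dom A f\<rbrakk> \<Longrightarrow> (f \<boxplus> f') \<cdot> h = f \<cdot> h \<boxplus> f' \<cdot> h"
  using assms Comp_Plus_right[of f "Dom A f" "Cod A f" f' g "Cod A g"]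
    Comp_Plus_left[of h "Dom A h" "Dom A f" f "Cod A f" f'] by auto

lemma Comp_Zero [simp]:
  "\<lbrakk>g \<in> Arr A; Dom A g = Y; X \<in> Obj A\<rbrakk> \<Longrightarrow> g \<cdot> Zero A X Y = Zero A X (Cod A g)"
  "\<lbrakk>g \<in> Arr A; Cod A g = Y; X \<in> Obj A\<rbrakk> \<Longrightarrow> Zero A Y X \<cdot> g = Zero A (Dom A g) X"
proof -
  assume *: "g \<in> Arr A" "Dom A g = Y" "X \<in> Obj A"
  then have Y: "Y \<in> Obj A" by auto
  have "g \<cdot> Zero A X Y \<boxplus> g \<cdot> Zero A X Y = g \<cdot> (Zero A X Y \<boxplus> Zero A X Y)"
    using * Y by (simp del: Plus_Zero)
  also have "\<dots> = g \<cdot> Zero A X Y" using * Y by simp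
  finally show "g \<cdot> Zero A X Y = Zero A X (Cod A g)"
    by (rule Plus_cancel_Zero) (use * Y in auto)
next
  assume *: "g \<in> Arr A" "Cod A g = Y" "X \<in> Obj A"
  then have Y: "Y \<in> Obj A" by auto
  have "Zero A Y X \<cdot> g \<boxplus> Zero A Y X \<cdot> g = (Zero A Y X \<boxplus> Zero A Y X) \<cdot> g"
    using * Y by (simp del: Plus_Zero)
  also have "\<dots> = Zero A Y X \<cdot> g" using * Y by simp
  finally show "Zero A Y X \<cdot> g = Zero A (Dom A g) X"
    by (rule Plus_cancel_Zero) (use * Y in auto)
qed

lemma monicD:
  "\<lbrakk>monic A k; k \<cdot> x = k \<cdot> y; x \<in> Arr A; y \<in> Arr A; Cod A x = Dom A k; Cod A y = Dom A k;
    Dom A x = Dom A y\<rbrakk> \<Longrightarrow> x = y"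
  unfolding monic_def by auto

lemma epicD:
  "\<lbrakk>epic A k; x \<cdot> k = y \<cdot> k; x \<in> Arr A; y \<in> Arr A; Dom A x = Cod A k; Dom A y = Cod A k;
    Cod A x = Cod A y\<rbrakk> \<Longrightarrow> x = y"
  unfolding epic_def by auto

lemma monic_ZeroD:
  assumes "monic A k" "x \<in> Arr A" "Cod A x = Dom A k" "k \<cdot> x = Zero A (Dom A x) (Cod A k)"
  shows "x = Zero A (Dom A x) (Dom A k)"
  using monicD[OF assms(1), of x "Zero A (Dom A x) (Dom A k)"] assms by (auto simp: monic_def)

lemma epic_ZeroD:
  assumes "epic A k" "x \<in> Arr A" "Dom A x = Cod A k" "x \<cdot> k = Zero A (Dom A k) (Cod A x)"
  shows "x = Zero A (Cod A k) (Cod A x)"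
  using epicD[OF assms(1), of x "Zero A (Cod A k) (Cod A x)"] assms by (auto simp: epic_def)

lemma monicI:
  assumes "k \<in> Arr A"
    and "\<And>x. \<lbrakk>x \<in> Arr A; Cod A x = Dom A k; k \<cdot> x = Zero A (Dom A x) (Cod A k)\<rbrakk>
          \<Longrightarrow> x = Zero A (Dom A x) (Dom A k)"
  shows "monic A k"
  unfolding monic_def
proof (intro conjI allI ballI impI)
  fix T g h assume g: "g \<in> arrows A T (Dom A k)" and h: "h \<in> arrows A T (Dom A k)"
    and eq: "k \<cdot> g = k \<cdot> h"
  obtain r where r: "r \<in> arrows A T (Dom A k)" "g = h \<boxplus> r"
    using difference_exists g h by blast
  have "k \<cdot> h \<boxplus> k \<cdot> r = k \<cdot> h" using eq r g h assms(1) by auto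
  then have "k \<cdot> r = Zero A T (Cod A k)"
    by (rule Plus_cancel_Zero) (use assms(1) r h in auto)
  then have "r = Zero A T (Dom A k)" using assms(2)[of r] r by auto
  then show "g = h" using r h by auto
qed (use assms(1) in auto)

text \<open>
  The uniqueness half of the universal property is exactly monicity, which leaves a bare existence
  statement to be checked for each kernel that is constructed later.
\<close>
lemma kernel_iff:
  "is_kernel A f k \<longleftrightarrow> f \<in> Arr A \<and> monic A k \<and> Cod A k = Dom A f \<and>
     f \<cdot> k = Zero A (Dom A k) (Cod A f) \<and>
     (\<forall>x\<in>Arr A. Cod A x = Dom A f \<longrightarrow> f \<cdot> x = Zero A (Dom A x) (Cod A f) \<longrightarrow>
        (\<exists>u\<in>arrows A (Dom A x) (Dom A k). k \<cdot> u = x))" (is "?L \<longleftrightarrow> ?R")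
proof
  assume L: ?L
  have "monic A k"
    unfolding monic_def
  proof (intro conjI allI ballI impI)
    fix T g h assume gh: "g \<in> arrows A T (Dom A k)" "h \<in> arrows A T (Dom A k)" "k \<cdot> g = k \<cdot> h"
    have "f \<cdot> (k \<cdot> g) = Zero A T (Cod A f)"
      using L gh Comp_triangle[of f k "Zero A (Dom A k) (Cod A f)" g]
      by (auto simp: is_kernel_def)
    moreover have "k \<cdot> g \<in> arrows A T (Dom A f)" using L gh by (auto simp: is_kernel_def)
    ultimately have "\<exists>!u. u \<in> arrows A T (Dom A k) \<and> k \<cdot> u = k \<cdot> g"
      using L unfolding is_kernel_def by blast
    then show "g = h" using gh by metis
  qed (use L in \<open>simp add: is_kernel_def\<close>)
  show ?R
  proof (intro conjI ballI impI)
    fix x assume x: "x \<in> Arr A" "Cod A x = Dom A f" "f \<cdot> x = Zero A (Dom A x) (Cod A f)"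
    then have "x \<in> arrows A (Dom A x) (Dom A f)" by simp
    then have "\<exists>!u. u \<in> arrows A (Dom A x) (Dom A k) \<and> k \<cdot> u = x"
      using L x(3) unfolding is_kernel_def by blast
    then show "\<exists>u\<in>arrows A (Dom A x) (Dom A k). k \<cdot> u = x" by blast
  qed (use L \<open>monic A k\<close> in \<open>simp_all add: is_kernel_def\<close>)
next
  assume R: ?R
  then have k: "monic A k" "k \<in> Arr A" by (auto simp: monic_def)
  show ?L unfolding is_kernel_def
  proof (intro conjI allI ballI impI)
    fix T x assume x: "x \<in> arrows A T (Dom A f)" "f \<cdot> x = Zero A T (Cod A f)"
    then have "x \<in> Arr A" "Dom A x = T" "Cod A x = Dom A f" by auto
    then obtain u where u: "u \<in> arrows A T (Dom A k)" "k \<cdot> u = x" using R x(2) by blast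
    show "\<exists>!u. u \<in> arrows A T (Dom A k) \<and> k \<cdot> u = x"
    proof (rule ex1I)
      show "u' = u" if "u' \<in> arrows A T (Dom A k) \<and> k \<cdot> u' = x" for u'
        using monicD[OF k(1), of u' u] u that by simp
    qed (use u in blast)
  qed (use R k in simp_all)
qed

end

section \<open>The opposite category\<close>

definition op :: "('o, 'm, 'z) preadditive_data_scheme \<Rightarrow> ('o, 'm, 'z) preadditive_data_scheme" where
  "op A = A\<lparr>Dom := Cod A, Cod := Dom A, Comp := (\<lambda>g f. Comp A f g),
            Zero := (\<lambda>X Y. Zero A Y X)\<rparr>"

lemma op_simps [simp]:
  "Obj (op A) = Obj A" "Arr (op A) = Arr A" "Dom (op A) = Cod A" "Cod (op A) = Dom A"
  "Ident (op A) = Ident A" "Comp (op A) g f = Comp A f g" "Plus (op A) = Plus A"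
  "Zero (op A) X Y = Zero A Y X"
  by (auto simp: op_def)

lemma op_op [simp]: "op (op A) = A"
  by (simp add: op_def)
lemma op_arrows: "arrows (op A) X Y = arrows A Y X"
  by auto

lemma op_Hom: "Hom (op A) X Y = Hom A Y X"
  by (simp add: Hom_def op_arrows)

lemma op_monic: "monic (op A) = epic A"
  and op_epic: "epic (op A) = monic A"
  by (auto simp: monic_def epic_def fun_eq_iff simp del: arrows_iff simp: op_arrows)

lemma op_kernel: "is_kernel (op A) = is_cokernel A"
  and op_cokernel: "is_cokernel (op A) = is_kernel A"
  by (auto simp: is_kernel_def is_cokernel_def fun_eq_iff simp del: arrows_iff simp: op_arrows)

lemma op_zero_object: "zero_object (op A) Z \<longleftrightarrow> zero_object A Z"
  by (auto simp: zero_object_def op_arrows simp del: arrows_iff)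

lemma op_direct_sum: "direct_sum (op A) X Y S \<longleftrightarrow> direct_sum A X Y S"
  unfolding direct_sum_def op_arrows op_simps by blast

lemma (in abelian_category) abelian_op: "abelian_category (op A)"
proof (intro abelian_category.intro preadditive_category.intro category.intro
    preadditive_category_axioms.intro abelian_category_axioms.intro)
  show "comm_group (Hom (op A) X Y)" if "X \<in> Obj (op A)" "Y \<in> Obj (op A)" for X Y
    using Hom_comm_group that by (simp add: op_Hom)
  show "\<exists>Z. zero_object (op A) Z"
    using has_zero_object by (simp add: op_zero_object)
  show "\<exists>S. direct_sum (op A) X Y S" if "X \<in> Obj (op A)" "Y \<in> Obj (op A)" for X Y
    using has_direct_sums that by (simp add: op_direct_sum)
  show "\<exists>k. is_kernel (op A) f k" if "f \<in> Arr (op A)" for f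
    using has_cokernels that by (simp add: op_kernel)
  show "\<exists>k. is_cokernel (op A) f k" if "f \<in> Arr (op A)" for f
    using has_kernels that by (simp add: op_cokernel)
  show "\<exists>f. is_kernel (op A) f k" if "monic (op A) k" for k
    using epic_is_cokernel that by (simp add: op_kernel op_monic)
  show "\<exists>f. is_cokernel (op A) f k" if "epic (op A) k" for k
    using monic_is_kernel that by (simp add: op_cokernel op_epic)
qed auto

context abelian_category
begin

lemma preadditive_op: "preadditive_category (op A)"
  using abelian_op by (rule abelian_category.axioms(1))

lemma epicI:
  assumes "k \<in> Arr A"
    and "\<And>x. \<lbrakk>x \<in> Arr A; Dom A x = Cod A k; x \<cdot> k = Zero A (Dom A k) (Cod A x)\<rbrakk>
          \<Longrightarrow> x = Zero A (Cod A k) (Cod A x)"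
  shows "epic A k"
  using preadditive_category.monicI[OF preadditive_op, of k] assms by (simp add: op_monic)

lemma cokernel_iff:
  "is_cokernel A f q \<longleftrightarrow> f \<in> Arr A \<and> epic A q \<and> Dom A q = Cod A f \<and>
     q \<cdot> f = Zero A (Dom A f) (Cod A q) \<and>
     (\<forall>x\<in>Arr A. Dom A x = Cod A f \<longrightarrow> x \<cdot> f = Zero A (Dom A f) (Cod A x) \<longrightarrow>
        (\<exists>u\<in>arrows A (Cod A q) (Cod A x). u \<cdot> q = x))"
  using preadditive_category.kernel_iff[OF preadditive_op, of f q]
  by (simp add: op_monic op_kernel op_arrows del: arrows_iff)

lemma kernelD:
  assumes "is_kernel A f k"
  shows "f \<in> Arr A" "k \<in> Arr A" "monic A k" "Cod A k = Dom A f"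
    "f \<cdot> k = Zero A (Dom A k) (Cod A f)"
  using assms unfolding kernel_iff monic_def by auto

lemma cokernelD:
  assumes "is_cokernel A f q"
  shows "f \<in> Arr A" "q \<in> Arr A" "epic A q" "Dom A q = Cod A f"
    "q \<cdot> f = Zero A (Dom A f) (Cod A q)"
  using assms unfolding cokernel_iff epic_def by auto

lemma kernel_factor_ex:
  assumes "is_kernel A f k" "x \<in> Arr A" "Cod A x = Dom A f" "f \<cdot> x = Zero A (Dom A x) (Cod A f)"
  shows "\<exists>u\<in>arrows A (Dom A x) (Dom A k). k \<cdot> u = x"
  using assms unfolding kernel_iff by blast

lemma kernel_factor:
  assumes "is_kernel A f k" "x \<in> Arr A" "Cod A x = Dom A f" "f \<cdot> x = Zero A (Dom A x) (Cod A f)"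
  obtains u where "u \<in> Arr A" "Dom A u = Dom A x" "Cod A u = Dom A k" "k \<cdot> u = x"
  using assms unfolding kernel_iff by (metis arrows_iff)

lemma cokernel_factor:
  assumes "is_cokernel A f q" "x \<in> Arr A" "Dom A x = Cod A f" "x \<cdot> f = Zero A (Dom A f) (Cod A x)"
  obtains u where "u \<in> Arr A" "Dom A u = Cod A q" "Cod A u = Cod A x" "u \<cdot> q = x"
  using assms unfolding cokernel_iff by (metis arrows_iff)

text \<open>
  If \<open>k\<close> is a kernel of \<open>f\<close>, then \<open>f\<close> factors through the cokernel \<open>q\<close> of \<open>k\<close>, so that whatever \<open>q\<close>
  annihilates is annihilated by \<open>f\<close> and therefore factors through \<open>k\<close>.
\<close>
lemma monic_is_kernel_of_cokernel:
  assumes k: "monic A k" and q: "is_cokernel A k q"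
  shows "is_kernel A q k"
proof -
  obtain f where f: "is_kernel A f k" using monic_is_kernel k by blast
  note t = kernelD[OF f] cokernelD[OF q]
  obtain f' where f': "f' \<in> Arr A" "Dom A f' = Cod A q" "Cod A f' = Cod A f" "f' \<cdot> q = f"
    using cokernel_factor[OF q, of f] t by auto
  have "\<exists>u\<in>arrows A (Dom A x) (Dom A k). k \<cdot> u = x"
    if x: "x \<in> Arr A" "Cod A x = Dom A q" "q \<cdot> x = Zero A (Dom A x) (Cod A q)" for x
  proof -
    have "f \<cdot> x = f' \<cdot> (q \<cdot> x)" using f' x t by (metis Comp_triangle)
    also have "\<dots> = Zero A (Dom A x) (Cod A f)" using x f' t by simp
    finally show ?thesis using kernel_factor_ex[OF f, of x] x t by auto
  qed
  then show ?thesis unfolding kernel_iff using k t by auto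
qed

lemma epic_is_cokernel_of_kernel:
  "\<lbrakk>epic A q; is_kernel A q k\<rbrakk> \<Longrightarrow> is_cokernel A k q"
  using abelian_category.monic_is_kernel_of_cokernel[OF abelian_op, of q k]
  by (simp add: op_monic op_kernel op_cokernel)

lemma monic_Comp:
  assumes "monic A f" "monic A g" "Cod A f = Dom A g"
  shows "monic A (g \<cdot> f)"
proof -
  have t: "f \<in> Arr A" "g \<in> Arr A" using assms by (auto simp: monic_def)
  show ?thesis
  proof (rule monicI)
    fix x assume x: "x \<in> Arr A" "Cod A x = Dom A (g \<cdot> f)"
      "(g \<cdot> f) \<cdot> x = Zero A (Dom A x) (Cod A (g \<cdot> f))"
    then have "f \<cdot> x = Zero A (Dom A x) (Cod A f)"
      using monic_ZeroD[OF assms(2), of "f \<cdot> x"] t assms(3) by simp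
    then show "x = Zero A (Dom A x) (Dom A (g \<cdot> f))"
      using monic_ZeroD[OF assms(1), of x] x t assms(3) by simp
  qed (use t assms in simp)
qed

lemma epic_Comp:
  "\<lbrakk>epic A f; epic A g; Cod A f = Dom A g\<rbrakk> \<Longrightarrow> epic A (g \<cdot> f)"
  using abelian_category.monic_Comp[OF abelian_op, of g f] by (simp add: op_monic)

text \<open>
  The monic part \<open>k\<close> is the image.  If \<open>g\<close> annihilates the other factor \<open>e\<close>, then \<open>f\<close> factors through
  the smaller subobject \<open>k \<cdot> l\<close>, where \<open>l\<close> is the kernel of \<open>g\<close>; as the image is the least
  subobject with this property, \<open>l\<close> splits and \<open>g\<close> is zero.
\<close>
lemma epic_monic_factorization:
  assumes f: "f \<in> Arr A"
  obtains e k where "epic A e" "monic A k" "Cod A e = Dom A k" "k \<cdot> e = f"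
proof -
  obtain q where q: "is_cokernel A f q" using has_cokernels f by blast
  obtain k where k: "is_kernel A q k" using has_kernels cokernelD(2)[OF q] by blast
  note t = cokernelD[OF q] kernelD[OF k]
  obtain e where e: "e \<in> Arr A" "Dom A e = Dom A f" "Cod A e = Dom A k" "k \<cdot> e = f"
    using kernel_factor[OF k, of f] t by auto
  have "epic A e"
  proof (rule epicI)
    fix g assume g: "g \<in> Arr A" "Dom A g = Cod A e" "g \<cdot> e = Zero A (Dom A e) (Cod A g)"
    obtain l where l: "is_kernel A g l" using has_kernels g by blast
    note tl = kernelD[OF l]
    obtain e' where e': "e' \<in> Arr A" "Dom A e' = Dom A e" "Cod A e' = Dom A l" "l \<cdot> e' = e"
      using kernel_factor[OF l, of e] g e by auto
    \<comment> \<open>Minimality of the image: \<open>k\<close> factors through \<open>k \<cdot> l\<close>, tested on the cokernel of \<open>k \<cdot> l\<close>.\<close>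
    have kl: "monic A (k \<cdot> l)" using monic_Comp[of l k] t tl g e by simp
    have tkl: "k \<cdot> l \<in> Arr A" using t tl g e by simp
    obtain r where r: "is_cokernel A (k \<cdot> l) r" using has_cokernels tkl by blast
    have rk: "is_kernel A r (k \<cdot> l)" using monic_is_kernel_of_cokernel kl r by blast
    note tr = cokernelD[OF r]
    have rkl: "r \<cdot> (k \<cdot> l) = Zero A (Dom A l) (Cod A r)" using tr(5) t tl g e by simp
    have "r \<cdot> f = (r \<cdot> (k \<cdot> l)) \<cdot> e'" using e e' t tl g tr(1-4) by simp
    also have "\<dots> = Zero A (Dom A f) (Cod A r)" unfolding rkl using e e' t tl g tr(1-4) by simp
    finally obtain r' where r': "r' \<in> Arr A" "Dom A r' = Cod A q" "Cod A r' = Cod A r" "r' \<cdot> q = r"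
      using cokernel_factor[OF q, of r] t tl g e tr(1-4) by auto
    have "r \<cdot> k = r' \<cdot> (q \<cdot> k)" using r' t by (metis Comp_assoc_typed)
    also have "\<dots> = Zero A (Dom A k) (Cod A r)" using r' t by simp
    finally obtain s where s: "s \<in> Arr A" "Dom A s = Dom A k" "Cod A s = Dom A l" "(k \<cdot> l) \<cdot> s = k"
      using kernel_factor[OF rk, of k] t tl g e tr(1-4) by auto
    have "l \<cdot> s = Ident A (Dom A k)"
      using monicD[OF t(8), of "l \<cdot> s" "Ident A (Dom A k)"] s t tl g e by simp
    then have "g = g \<cdot> (l \<cdot> s)" using g e t by simp
    also have "\<dots> = Zero A (Cod A e) (Cod A g)"
      using Comp_triangle[OF tl(5), of s] s t tl g e by simp
    finally show "g = Zero A (Cod A e) (Cod A g)" .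
  qed (use e in simp)
  then show thesis using that t e by blast
qed

text \<open>
  A quotient map \<open>p\<close> followed by \<open>u\<close> has the same kernel as \<open>p\<close> only if \<open>u\<close> is injective.
  Factor \<open>u = k \<cdot> e\<close>: then \<open>e \<cdot> p\<close> is epic with kernel \<open>i\<close>, so it is a cokernel of \<open>i\<close> and \<open>p\<close>
  factors back through it, which splits \<open>e\<close>.  Pullbacks along epimorphisms are thereby avoided.
\<close>

lemma monic_if_same_kernel:
  assumes p: "epic A p" and u: "u \<in> Arr A" "Dom A u = Cod A p"
    and i: "is_kernel A (u \<cdot> p) i" and pi: "p \<cdot> i = Zero A (Dom A i) (Cod A p)"
  shows "monic A u"
proof -
  have tp: "p \<in> Arr A" using p by (simp add: epic_def)
  obtain e k where ek: "epic A e" "monic A k" "Cod A e = Dom A k" "k \<cdot> e = u"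
    using epic_monic_factorization u by blast
  then have t: "e \<in> Arr A" "k \<in> Arr A" by (auto simp: epic_def monic_def)
  have d: "Dom A e = Cod A p" "Cod A k = Cod A u" using ek t u by auto
  note ti = kernelD[OF i]
  have ip: "i \<in> Arr A" "Cod A i = Dom A p" using ti u tp by auto
  have "epic A (e \<cdot> p)" using epic_Comp p ek(1) d by simp
  moreover have "is_kernel A (e \<cdot> p) i"
    unfolding kernel_iff
  proof (intro conjI ballI impI)
    show "(e \<cdot> p) \<cdot> i = Zero A (Dom A i) (Cod A (e \<cdot> p))" using pi ip t tp d by simp
    fix x assume x: "x \<in> Arr A" "Cod A x = Dom A (e \<cdot> p)"
      "(e \<cdot> p) \<cdot> x = Zero A (Dom A x) (Cod A (e \<cdot> p))"
    have "(u \<cdot> p) \<cdot> x = k \<cdot> ((e \<cdot> p) \<cdot> x)"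
      unfolding ek(4)[symmetric] using x(1,2) t tp d ek(3) by simp
    also have "\<dots> = Zero A (Dom A x) (Cod A (u \<cdot> p))"
      unfolding x(3) using x(1) t tp d ek(3) u by simp
    finally show "\<exists>v\<in>arrows A (Dom A x) (Dom A i). i \<cdot> v = x"
      using kernel_factor_ex[OF i, of x] x t tp d u by auto
  qed (use t tp d ti ip in auto)
  ultimately have "is_cokernel A i (e \<cdot> p)" by (rule epic_is_cokernel_of_kernel)
  then obtain s where s: "s \<in> Arr A" "Dom A s = Cod A e" "Cod A s = Cod A p" "s \<cdot> (e \<cdot> p) = p"
    using cokernel_factor[of i "e \<cdot> p" p] pi ip t tp d by auto
  have se: "s \<cdot> e = Ident A (Cod A p)"
    using epicD[OF p, of "s \<cdot> e" "Ident A (Cod A p)"] s t tp d by simp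
  show ?thesis
  proof (rule monicI)
    fix x assume x: "x \<in> Arr A" "Cod A x = Dom A u" "u \<cdot> x = Zero A (Dom A x) (Cod A u)"
    have "k \<cdot> (e \<cdot> x) = Zero A (Dom A x) (Cod A k)"
      using x Comp_triangle[OF ek(4), of x] t d u ek(3) by simp
    then have "e \<cdot> x = Zero A (Dom A x) (Cod A e)"
      using monic_ZeroD[OF ek(2), of "e \<cdot> x"] x t d u ek(3) by simp
    then have "x = s \<cdot> Zero A (Dom A x) (Cod A e)"
      using Comp_triangle[OF se, of x] x t d u s by simp
    then show "x = Zero A (Dom A x) (Dom A u)" using x s u by simp
  qed (fact u)
qed

end

section \<open>Conflations relative to a class of objects\<close>

text \<open>
  In the exact structure given by these sequences, the last two conditions say that every object of
  \<open>\<X>\<close> is projective and injective.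
\<close>
definition conflation ::
  "('o, 'm, 'z) preadditive_data_scheme \<Rightarrow> 'o set \<Rightarrow> 'm \<Rightarrow> 'm \<Rightarrow> bool" where
  "conflation A \<X> i p \<longleftrightarrow> is_kernel A p i \<and> is_cokernel A i p \<and>
     (\<forall>V\<in>\<X>. \<forall>f\<in>arrows A V (Cod A p). \<exists>g\<in>arrows A V (Dom A p). p \<cdot>\<^bsub>A\<^esub> g = f) \<and>
     (\<forall>V\<in>\<X>. \<forall>f\<in>arrows A (Dom A i) V. \<exists>g\<in>arrows A (Cod A i) V. g \<cdot>\<^bsub>A\<^esub> i = f)"

lemma op_conflation: "conflation (op A) \<X> p i \<longleftrightarrow> conflation A \<X> i p"
  unfolding conflation_def op_arrows op_kernel op_cokernel op_simps by blast

lemma conflation_mono: "\<lbrakk>conflation A \<Y> i p; \<X> \<subseteq> \<Y>\<rbrakk> \<Longrightarrow> conflation A \<X> i p"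
  unfolding conflation_def by blast

context abelian_category
begin

lemma conflationI:
  assumes "monic A i" "is_cokernel A i p"
    and "\<And>V f. \<lbrakk>V \<in> \<X>; f \<in> Arr A; Dom A f = V; Cod A f = Cod A p\<rbrakk>
          \<Longrightarrow> \<exists>g\<in>arrows A V (Dom A p). p \<cdot> g = f"
    and "\<And>V f. \<lbrakk>V \<in> \<X>; f \<in> Arr A; Dom A f = Dom A i; Cod A f = V\<rbrakk>
          \<Longrightarrow> \<exists>g\<in>arrows A (Cod A i) V. g \<cdot> i = f"
  shows "conflation A \<X> i p"
  unfolding conflation_def using assms monic_is_kernel_of_cokernel[OF assms(1,2)] by auto

lemma conflationD:
  assumes "conflation A \<X> i p"
  shows "i \<in> Arr A" "p \<in> Arr A" "Cod A i = Dom A p" "p \<cdot> i = Zero A (Dom A i) (Cod A p)"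
    "monic A i" "epic A p" "is_kernel A p i" "is_cokernel A i p"
  using assms kernelD[of p i] cokernelD[of i p] unfolding conflation_def by auto

lemma conflation_lift:
  assumes "conflation A \<X> i p" "Dom A f \<in> \<X>" "f \<in> Arr A" "Cod A f = Cod A p"
  obtains g where "g \<in> Arr A" "Dom A g = Dom A f" "Cod A g = Dom A p" "p \<cdot> g = f"
  using assms unfolding conflation_def by (metis arrows_iff)

lemma conflation_extend:
  assumes "conflation A \<X> i p" "Cod A f \<in> \<X>" "f \<in> Arr A" "Dom A f = Dom A i"
  obtains g where "g \<in> Arr A" "Dom A g = Cod A i" "Cod A g = Cod A f" "g \<cdot> i = f"
  using assms unfolding conflation_def by (metis arrows_iff)

text \<open>
  Two admissible monomorphisms compose, and the cokernels are related as in the third isomorphism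
  theorem: with \<open>C\<close> the cokernel of \<open>j \<cdot> i\<close>, the cokernel of \<open>i\<close> embeds in \<open>C\<close> with quotient the
  cokernel of \<open>j\<close>.  The induced sequence \<open>(u, v)\<close> is treated first, because lifting to the middle
  term of the composite uses it: a lift modulo the image of \<open>u\<close> is found along \<open>q\<close>, and the
  remaining error, which comes from the cokernel of \<open>i\<close>, is lifted along \<open>p\<close>.
\<close>
lemma conflation_composite:
  assumes ip: "conflation A \<X> i p" and jq: "conflation A \<X> j q" and ji: "Dom A j = Cod A i"
  obtains c u v where "conflation A \<X> (j \<cdot> i) c" "conflation A \<X> u v"
    "Dom A u = Cod A p" "Cod A u = Cod A c" "Cod A v = Cod A q"
proof -
  note t1 = conflationD[OF ip] and t2 = conflationD[OF jq]
  have tji: "j \<cdot> i \<in> Arr A" "Dom A (j \<cdot> i) = Dom A i" "Cod A (j \<cdot> i) = Cod A j"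
    using t1 t2 ji by auto
  have mji: "monic A (j \<cdot> i)" using monic_Comp t1 t2 ji by simp
  obtain c where c: "is_cokernel A (j \<cdot> i) c" using has_cokernels tji by blast
  have cji: "is_kernel A c (j \<cdot> i)" using monic_is_kernel_of_cokernel mji c .
  have tc: "c \<in> Arr A" "epic A c" "Dom A c = Cod A j" and
    cji0: "c \<cdot> (j \<cdot> i) = Zero A (Dom A i) (Cod A c)"
    using cokernelD[OF c] tji by auto
  obtain u where u: "u \<in> Arr A" "Dom A u = Cod A p" "Cod A u = Cod A c" "u \<cdot> p = c \<cdot> j"
    using cokernel_factor[OF t1(8), of "c \<cdot> j"] cji0 t1 t2 tc ji by auto
  have qji: "q \<cdot> (j \<cdot> i) = Zero A (Dom A i) (Cod A q)"
    using Comp_triangle[OF t2(4), of i] t1 t2 ji by simp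
  obtain v where v: "v \<in> Arr A" "Dom A v = Cod A c" "Cod A v = Cod A q" "v \<cdot> c = q"
    using cokernel_factor[OF c, of q] qji tji t2 by auto
  note t = t1(1-3) t2(1-3) ji tc u(1-3) v(1-3)
  note eqs = u(4) Comp_square[OF u(4)] v(4) Comp_triangle[OF v(4)]
    t1(4) t2(4) Comp_triangle[OF t1(4)] Comp_triangle[OF t2(4)]
  have ev: "epic A v"
  proof (rule epicI)
    fix x assume x: "x \<in> Arr A" "Dom A x = Cod A v" "x \<cdot> v = Zero A (Dom A v) (Cod A x)"
    have "x \<cdot> q = Zero A (Dom A q) (Cod A x)"
      using Comp_triangle[OF x(3), of c] x(1,2) t eqs by simp
    then show "x = Zero A (Cod A v) (Cod A x)"
      using epic_ZeroD[OF t2(6), of x] x(1,2) t by simp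
  qed (use t in simp)
  have vu: "v \<cdot> u = Zero A (Dom A u) (Cod A v)"
    using epic_ZeroD[OF t1(6), of "v \<cdot> u"] t eqs by simp
  have coker: "is_cokernel A u v"
    unfolding cokernel_iff
  proof (intro conjI ballI impI)
    fix x assume x: "x \<in> Arr A" "Dom A x = Cod A u" "x \<cdot> u = Zero A (Dom A u) (Cod A x)"
    have "(x \<cdot> c) \<cdot> j = Zero A (Dom A j) (Cod A x)"
      using Comp_triangle[OF x(3), of p] x(1,2) t eqs by simp
    then obtain y where y: "y \<in> Arr A" "Dom A y = Cod A q" "Cod A y = Cod A x" "y \<cdot> q = x \<cdot> c"
      using cokernel_factor[OF t2(8), of "x \<cdot> c"] x(1,2) t by auto
    have "y \<cdot> v = x" using epicD[OF tc(2), of "y \<cdot> v" x] x(1,2) y t eqs by simp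
    then show "\<exists>y\<in>arrows A (Cod A v) (Cod A x). y \<cdot> v = x" using y t by (intro bexI[of _ y]) simp_all
  qed (use t vu ev in auto)
  \<comment> \<open>Both \<open>p\<close> and \<open>u \<cdot> p\<close> have kernel \<open>i\<close>, which forces \<open>u\<close> to be monic.\<close>
  have "is_kernel A (u \<cdot> p) i"
    unfolding kernel_iff
  proof (intro conjI ballI impI)
    show "(u \<cdot> p) \<cdot> i = Zero A (Dom A i) (Cod A (u \<cdot> p))" using t t1(4) by simp
    fix x assume x: "x \<in> Arr A" "Cod A x = Dom A (u \<cdot> p)"
      "(u \<cdot> p) \<cdot> x = Zero A (Dom A x) (Cod A (u \<cdot> p))"
    have "c \<cdot> (j \<cdot> x) = Zero A (Dom A x) (Cod A c)" using x t eqs by simp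
    then obtain r where r: "r \<in> Arr A" "Dom A r = Dom A x" "Cod A r = Dom A i" "(j \<cdot> i) \<cdot> r = j \<cdot> x"
      using kernel_factor[OF cji, of "j \<cdot> x"] x t by auto
    have "i \<cdot> r = x" using monicD[OF t2(5), of "i \<cdot> r" x] r x t by simp
    then show "\<exists>r\<in>arrows A (Dom A x) (Dom A i). i \<cdot> r = x" using r by (intro bexI[of _ r]) simp_all
  qed (use t1 t in auto)
  then have mu: "monic A u" using monic_if_same_kernel[OF t1(6) u(1,2)] t1 by blast
  have uv: "conflation A \<X> u v"
  proof (rule conflationI[OF mu coker])
    fix V f assume f: "V \<in> \<X>" "f \<in> Arr A" "Dom A f = V" "Cod A f = Cod A v"
    then obtain g where g: "g \<in> Arr A" "Dom A g = V" "Cod A g = Dom A q" "q \<cdot> g = f"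
      using conflation_lift[OF jq, of f] t by auto
    then show "\<exists>g\<in>arrows A V (Dom A v). v \<cdot> g = f"
      using f t eqs by (intro bexI[of _ "c \<cdot> g"]) simp_all
  next
    fix V f assume f: "V \<in> \<X>" "f \<in> Arr A" "Dom A f = Dom A u" "Cod A f = V"
    then obtain h where h: "h \<in> Arr A" "Dom A h = Cod A j" "Cod A h = V" "h \<cdot> j = f \<cdot> p"
      using conflation_extend[OF jq, of "f \<cdot> p"] t by auto
    have "h \<cdot> (j \<cdot> i) = Zero A (Dom A i) V"
      using Comp_square[OF h(4), of i] f h(1-3) t eqs by simp
    then obtain g where g: "g \<in> Arr A" "Dom A g = Cod A c" "Cod A g = V" "g \<cdot> c = h"
      using cokernel_factor[OF c, of h] h tji t by auto
    have "g \<cdot> u = f"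
      using epicD[OF t1(6), of "g \<cdot> u" f] Comp_triangle[OF g(4), of j] f g(1-3) h t eqs by simp
    then show "\<exists>g\<in>arrows A (Cod A u) V. g \<cdot> u = f" using g t by (intro bexI[of _ g]) simp_all
  qed
  have "conflation A \<X> (j \<cdot> i) c"
  proof (rule conflationI[OF mji c])
    fix V f assume f: "V \<in> \<X>" "f \<in> Arr A" "Dom A f = V" "Cod A f = Cod A c"
    then obtain g where g: "g \<in> Arr A" "Dom A g = V" "Cod A g = Dom A q" "q \<cdot> g = v \<cdot> f"
      using conflation_lift[OF jq, of "v \<cdot> f"] t by auto
    have "f \<in> arrows A V (Cod A c)" "c \<cdot> g \<in> arrows A V (Cod A c)"
      using f g t by simp_all
    then obtain r where r0: "r \<in> arrows A V (Cod A c)" and r_eq: "f = c \<cdot> g \<boxplus> r"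
      by (rule difference_exists)
    then have r: "r \<in> Arr A" "Dom A r = V" "Cod A r = (Cod A c)"
      by simp_all
    have "v \<cdot> f \<boxplus> v \<cdot> r = v \<cdot> f"
      using g f r(1-3) t eqs arg_cong[OF r_eq, of "\<lambda>z. v \<cdot> z"] by simp
    then have "v \<cdot> r = Zero A V (Cod A v)"
      by (rule Plus_cancel_Zero) (use f r(1-3) t in auto)
    then obtain h where h: "h \<in> Arr A" "Dom A h = V" "Cod A h = Dom A u" "u \<cdot> h = r"
      using kernel_factor[OF conflationD(7)[OF uv], of r] r(1-3) t by auto
    obtain h' where h': "h' \<in> Arr A" "Dom A h' = V" "Cod A h' = Dom A p" "p \<cdot> h' = h"
      using conflation_lift[OF ip, of h] h f t by auto
    have "c \<cdot> (j \<cdot> h') = u \<cdot> (p \<cdot> h')" using h'(1-3) t eqs by simp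
    then have "c \<cdot> (g \<boxplus> j \<cdot> h') = f" using r_eq h h' g t by simp
    then show "\<exists>g\<in>arrows A V (Dom A c). c \<cdot> g = f"
      using g h' t by (intro bexI[of _ "g \<boxplus> j \<cdot> h'"]) simp_all
  next
    fix V f assume f: "V \<in> \<X>" "f \<in> Arr A" "Dom A f = Dom A (j \<cdot> i)" "Cod A f = V"
    then obtain g where g: "g \<in> Arr A" "Dom A g = Cod A i" "Cod A g = V" "g \<cdot> i = f"
      using conflation_extend[OF ip, of f] t by auto
    then obtain h where h: "h \<in> Arr A" "Dom A h = Cod A j" "Cod A h = V" "h \<cdot> j = g"
      using conflation_extend[OF jq, of g] f t by auto
    have "h \<cdot> (j \<cdot> i) = f" using Comp_triangle[OF h(4), of i] h(1-3) g t by simp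
    then show "\<exists>g\<in>arrows A (Cod A (j \<cdot> i)) V. g \<cdot> (j \<cdot> i) = f" using h t by (intro bexI[of _ h]) simp_all
  qed
  then show thesis using that uv t by blast
qed

text \<open>
  Given an extension \<open>X \<rightarrow> E \<rightarrow> Y\<close> and conflations starting at \<open>X\<close> and \<open>Y\<close> with middle terms in \<open>\<X>\<close>,
  relative injectivity extends \<open>a\<close> along \<open>i\<close> to some \<open>\<alpha>\<close>, and \<open>(\<alpha>, b \<cdot> p)\<close> embeds \<open>E\<close> into the direct
  sum.  Its cokernel is an extension of the two given cokernels, as in the nine lemma.  Lifting and
  extension properties are inherited from the outer conflations, one end at a time with a
  correction of the remaining difference.
\<close>
lemma horseshoe:
  assumes ip: "conflation A \<X> i p" and a: "conflation A \<X> a a'" and b: "conflation A \<X> b b'"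
    and ends: "Dom A a = Dom A i" "Dom A b = Cod A p"
    and inj: "Cod A a \<in> \<X>" "Cod A b \<in> \<X>" and sum: "direct_sum A (Cod A a) (Cod A b) S"
  obtains s c u v where "conflation A \<X> s c" "Dom A s = Cod A i" "Cod A s = S"
    "conflation A \<X> u v" "Dom A u = Cod A a'" "Cod A u = Cod A c" "Cod A v = Cod A b'"
proof -
  note ti = conflationD[OF ip] and ta = conflationD[OF a] and tb = conflationD[OF b]
  obtain j1 j2 q1 q2 where
    tS: "j1 \<in> Arr A" "Dom A j1 = Cod A a" "Cod A j1 = S"
      "j2 \<in> Arr A" "Dom A j2 = Cod A b" "Cod A j2 = S"
      "q1 \<in> Arr A" "Dom A q1 = S" "Cod A q1 = Cod A a"
      "q2 \<in> Arr A" "Dom A q2 = S" "Cod A q2 = Cod A b"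
    and S: "q1 \<cdot> j1 = Ident A (Cod A a)" "q2 \<cdot> j2 = Ident A (Cod A b)"
      "q1 \<cdot> j2 = Zero A (Cod A b) (Cod A a)" "q2 \<cdot> j1 = Zero A (Cod A a) (Cod A b)"
      "(j1 \<cdot> q1) \<boxplus> (j2 \<cdot> q2) = Ident A S"
    using sum unfolding direct_sum_def by auto
  have oS: "S \<in> Obj A" using tS Cod_Obj by metis
  obtain \<alpha> where al: "\<alpha> \<in> Arr A" "Dom A \<alpha> = Cod A i" "Cod A \<alpha> = Cod A a" "\<alpha> \<cdot> i = a"
    using conflation_extend[OF ip, of a] inj ends ta by auto
  note t0 = ti(1-3) ta(1-3) tb(1-3) ends tS al(1-3) oS
  define s where "s = j1 \<cdot> \<alpha> \<boxplus> j2 \<cdot> (b \<cdot> p)"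
  have ts: "s \<in> Arr A" "Dom A s = Cod A i" "Cod A s = S" unfolding s_def using t0 by auto
  have q2s: "q2 \<cdot> s = b \<cdot> p" and q1s: "q1 \<cdot> s = \<alpha>" and si: "s \<cdot> i = j1 \<cdot> a"
    unfolding s_def using t0 Comp_triangle[OF S(1)] Comp_triangle[OF S(2)]
      Comp_triangle[OF S(3)] Comp_triangle[OF S(4)] ti(4) al(4) by simp_all
  note e0 = q2s Comp_triangle[OF q2s] q1s Comp_triangle[OF q1s] si Comp_square[OF si]
    ti(4) ta(4) tb(4) Comp_triangle[OF ti(4)] Comp_triangle[OF ta(4)] Comp_triangle[OF tb(4)]
    S(1-4) Comp_triangle[OF S(1)] Comp_triangle[OF S(2)] Comp_triangle[OF S(3)]
    Comp_triangle[OF S(4)] al(4) Comp_triangle[OF al(4)]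
  \<comment> \<open>An arrow into the middle term whose second component vanishes comes from the left end.\<close>
  have from_left: thesis
    if x: "x \<in> Arr A" "Cod A x = Cod A i" "b \<cdot> (p \<cdot> x) = Zero A (Dom A x) (Cod A b)"
      and r: "\<And>r. \<lbrakk>r \<in> Arr A; Dom A r = Dom A x; Cod A r = Dom A i; i \<cdot> r = x\<rbrakk> \<Longrightarrow> thesis"
    for x thesis
  proof -
    have px: "p \<cdot> x = Zero A (Dom A x) (Cod A p)"
      using monic_ZeroD[OF tb(5), of "p \<cdot> x"] x t0 by simp
    show thesis
      by (rule kernel_factor[OF ti(7) _ _ px]) (use x r t0 in simp_all)
  qed
  have ms: "monic A s"
  proof (rule monicI)
    fix x assume x: "x \<in> Arr A" "Cod A x = Dom A s" "s \<cdot> x = Zero A (Dom A x) (Cod A s)"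
    have 1: "q2 \<cdot> (s \<cdot> x) = b \<cdot> (p \<cdot> x)" "q1 \<cdot> (s \<cdot> x) = \<alpha> \<cdot> x"
      using x(1,2) t0 ts e0 by auto
    have "b \<cdot> (p \<cdot> x) = Zero A (Dom A x) (Cod A b)" using x 1 t0 ts by simp
    then obtain r where r: "r \<in> Arr A" "Dom A r = Dom A x" "Cod A r = Dom A i" "i \<cdot> r = x"
      using from_left[of x] x(1,2) ts by metis
    have "a \<cdot> r = \<alpha> \<cdot> x" using r Comp_triangle[OF al(4), of r] t0 by simp
    also have "\<dots> = Zero A (Dom A x) (Cod A a)" using x 1 t0 ts by simp
    finally have "r = Zero A (Dom A x) (Dom A i)"
      using monic_ZeroD[OF ta(5), of r] r t0 by simp
    then show "x = Zero A (Dom A x) (Dom A s)" using r x(1,2) t0 ts by auto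
  qed (use ts in simp)
  obtain c where c: "is_cokernel A s c" using has_cokernels ts by blast
  have sc: "is_kernel A c s" using monic_is_kernel_of_cokernel ms c .
  note tc = cokernelD[OF c]
  have c_j1_a: "c \<cdot> (j1 \<cdot> a) = Zero A (Dom A a) (Cod A c)"
    using Comp_triangle[OF tc(5), of i] tc(1-4) ts t0 e0 by simp
  obtain u where u: "u \<in> Arr A" "Dom A u = Cod A a'" "Cod A u = Cod A c" "u \<cdot> a' = c \<cdot> j1"
    using cokernel_factor[OF ta(8), of "c \<cdot> j1"] c_j1_a t0 ts tc(1-4) by auto
  obtain v where v: "v \<in> Arr A" "Dom A v = Cod A c" "Cod A v = Cod A b'" "v \<cdot> c = b' \<cdot> q2"
    using cokernel_factor[OF c, of "b' \<cdot> q2"] e0 t0 ts by auto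
  note t = t0 ts tc(1-4) u(1-3) v(1-3)
  note eqs = e0 u(4) Comp_square[OF u(4)] v(4) Comp_square[OF v(4)]
  have ev: "epic A v"
  proof (rule epicI)
    fix x assume x: "x \<in> Arr A" "Dom A x = Cod A v" "x \<cdot> v = Zero A (Dom A v) (Cod A x)"
    have "x \<cdot> b' = Zero A (Dom A b') (Cod A x)"
      using Comp_triangle[OF x(3), of "c \<cdot> j2"] x(1,2) t eqs by simp
    then show "x = Zero A (Cod A v) (Cod A x)"
      using epic_ZeroD[OF tb(6), of x] x(1,2) t by simp
  qed (use t in simp)
  have vu: "v \<cdot> u = Zero A (Dom A u) (Cod A v)"
    using epic_ZeroD[OF ta(6), of "v \<cdot> u"] t eqs by simp
  \<comment> \<open>An arrow out of the sum is determined by its restrictions to the two summands.\<close>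
  have split: "x = x \<cdot> (j1 \<cdot> q1) \<boxplus> x \<cdot> (j2 \<cdot> q2)" if "x \<in> Arr A" "Dom A x = S" for x
  proof -
    have "x = x \<cdot> ((j1 \<cdot> q1) \<boxplus> (j2 \<cdot> q2))" unfolding S(5) using that by simp
    then show ?thesis using that t by simp
  qed
  have coker: "is_cokernel A u v"
    unfolding cokernel_iff
  proof (intro conjI ballI impI)
    fix x assume x: "x \<in> Arr A" "Dom A x = Cod A u" "x \<cdot> u = Zero A (Dom A u) (Cod A x)"
    have 1: "x \<cdot> (c \<cdot> j1) = Zero A (Cod A a) (Cod A x)"
      using Comp_triangle[OF x(3), of a'] x(1,2) t eqs by simp
    have 2: "x \<cdot> c = x \<cdot> (c \<cdot> (j2 \<cdot> q2))"
      using split[of "x \<cdot> c"] Comp_triangle[OF 1, of q1] x(1,2) t by simp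
    have "x \<cdot> (c \<cdot> (j2 \<cdot> (b \<cdot> p))) = (x \<cdot> (c \<cdot> (j2 \<cdot> q2))) \<cdot> s"
      using x(1,2) t eqs by simp
    also have "\<dots> = Zero A (Cod A i) (Cod A x)"
      unfolding 2[symmetric] using tc(5) x(1,2) t by simp
    finally have "x \<cdot> (c \<cdot> (j2 \<cdot> b)) = Zero A (Dom A b) (Cod A x)"
      using epic_ZeroD[OF ti(6), of "x \<cdot> (c \<cdot> (j2 \<cdot> b))"] x(1,2) t by simp
    then obtain y where y: "y \<in> Arr A" "Dom A y = Cod A b'" "Cod A y = Cod A x"
        "y \<cdot> b' = x \<cdot> (c \<cdot> j2)"
      using cokernel_factor[OF tb(8), of "x \<cdot> (c \<cdot> j2)"] x(1,2) t by auto
    have "y \<cdot> v = x"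
      using epicD[OF tc(3), of "y \<cdot> v" x] Comp_square[OF y(4), of q2] 2 x(1,2) y(1-3) t eqs by simp
    then show "\<exists>y\<in>arrows A (Cod A v) (Cod A x). y \<cdot> v = x" using y t by (intro bexI[of _ y]) simp_all
  qed (use t vu ev in auto)
  \<comment> \<open>Both \<open>a'\<close> and \<open>u \<cdot> a'\<close> have kernel \<open>a\<close>, which forces \<open>u\<close> to be monic.\<close>
  have "is_kernel A (u \<cdot> a') a"
    unfolding kernel_iff
  proof (intro conjI ballI impI)
    show "(u \<cdot> a') \<cdot> a = Zero A (Dom A a) (Cod A (u \<cdot> a'))" using c_j1_a t eqs by simp
    fix x assume x: "x \<in> Arr A" "Cod A x = Dom A (u \<cdot> a')"
      "(u \<cdot> a') \<cdot> x = Zero A (Dom A x) (Cod A (u \<cdot> a'))"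
    have "c \<cdot> (j1 \<cdot> x) = Zero A (Dom A x) (Cod A c)" using x t eqs by simp
    then obtain y where y: "y \<in> Arr A" "Dom A y = Dom A x" "Cod A y = Dom A s" "s \<cdot> y = j1 \<cdot> x"
      using kernel_factor[OF sc, of "j1 \<cdot> x"] x t by auto
    have "b \<cdot> (p \<cdot> y) = q2 \<cdot> (s \<cdot> y)" using y(1-3) t eqs by simp
    also have "\<dots> = Zero A (Dom A y) (Cod A b)" unfolding y(4) using x y(1-3) t eqs by simp
    finally obtain r where r: "r \<in> Arr A" "Dom A r = Dom A x" "Cod A r = Dom A i" "i \<cdot> r = y"
      using from_left[of y] y(1-3) ts by metis
    have "a \<cdot> r = q1 \<cdot> (j1 \<cdot> (a \<cdot> r))" using r(1-3) t eqs by simp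
    also have "\<dots> = q1 \<cdot> (s \<cdot> y)" unfolding r(4)[symmetric] using r(1-3) t eqs by simp
    also have "\<dots> = x" unfolding y(4) using x t eqs by simp
    finally show "\<exists>r\<in>arrows A (Dom A x) (Dom A a). a \<cdot> r = x" using r t by (intro bexI[of _ r]) simp_all
  qed (use ta t in auto)
  then have mu: "monic A u" using monic_if_same_kernel[OF ta(6) u(1,2)] ta by blast
  have uv: "conflation A \<X> u v"
  proof (rule conflationI[OF mu coker])
    fix V f assume f: "V \<in> \<X>" "f \<in> Arr A" "Dom A f = V" "Cod A f = Cod A v"
    then obtain g where g: "g \<in> Arr A" "Dom A g = V" "Cod A g = Dom A b'" "b' \<cdot> g = f"
      using conflation_lift[OF b, of f] t by auto
    then show "\<exists>g\<in>arrows A V (Dom A v). v \<cdot> g = f"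
      using f t eqs by (intro bexI[of _ "c \<cdot> (j2 \<cdot> g)"]) simp_all
  next
    fix V f assume f: "V \<in> \<X>" "f \<in> Arr A" "Dom A f = Dom A u" "Cod A f = V"
    have oV: "V \<in> Obj A" using f by auto
    have "(f \<cdot> (a' \<cdot> \<alpha>)) \<cdot> i = Zero A (Dom A i) V" using f t eqs by simp
    then obtain k where k: "k \<in> Arr A" "Dom A k = Cod A p" "Cod A k = V" "k \<cdot> p = f \<cdot> (a' \<cdot> \<alpha>)"
      using cokernel_factor[OF ti(8), of "f \<cdot> (a' \<cdot> \<alpha>)"] f t by auto
    have "Zero A (Cod A p) V \<in> arrows A (Cod A p) V" "k \<in> arrows A (Cod A p) V"
      using k oV t by simp_all
    then obtain k' where k'0: "k' \<in> arrows A (Cod A p) V" and k'_eq: "Zero A (Cod A p) V = k \<boxplus> k'"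
      by (rule difference_exists)
    then have k': "k' \<in> Arr A" "Dom A k' = (Cod A p)" "Cod A k' = V"
      by simp_all
    obtain g where g: "g \<in> Arr A" "Dom A g = Cod A b" "Cod A g = V" "g \<cdot> b = k'"
      using conflation_extend[OF b, of k'] k' f t by auto
    \<comment> \<open>
      On the second summand \<open>g\<close> extends \<open>- k\<close>, so that the two contributions to \<open>h \<cdot> s\<close> cancel.
    \<close>
    define h where "h = f \<cdot> (a' \<cdot> q1) \<boxplus> g \<cdot> q2"
    have th: "h \<in> Arr A" "Dom A h = S" "Cod A h = V" unfolding h_def using f g(1-3) t by auto
    have "h \<cdot> s = k \<cdot> p \<boxplus> k' \<cdot> p"
      unfolding h_def k(4) using Comp_triangle[OF g(4), of p] f g(1-3) t eqs by simp
    also have "\<dots> = (k \<boxplus> k') \<cdot> p" using k(1-3) k'(1-3) t by simp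
    also have "\<dots> = Zero A (Dom A s) V" unfolding k'_eq[symmetric] using oV t by simp
    finally obtain w where w: "w \<in> Arr A" "Dom A w = Cod A c" "Cod A w = V" "w \<cdot> c = h"
      using cokernel_factor[OF c, of h] th t by auto
    have hj: "h \<cdot> j1 = f \<cdot> a'" unfolding h_def using f g(1-3) t eqs by simp
    have "w \<cdot> u = f"
      using epicD[OF ta(6), of "w \<cdot> u" f] Comp_triangle[OF w(4), of j1] hj f w(1-3) t eqs by simp
    then show "\<exists>g\<in>arrows A (Cod A u) V. g \<cdot> u = f" using w t by (intro bexI[of _ w]) simp_all
  qed
  have "conflation A \<X> s c"
  proof (rule conflationI[OF ms c])
    fix V f assume f: "V \<in> \<X>" "f \<in> Arr A" "Dom A f = V" "Cod A f = Cod A c"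
    then obtain g where g: "g \<in> Arr A" "Dom A g = V" "Cod A g = Dom A b'" "b' \<cdot> g = v \<cdot> f"
      using conflation_lift[OF b, of "v \<cdot> f"] t by auto
    have "f \<in> arrows A V (Cod A c)" "c \<cdot> (j2 \<cdot> g) \<in> arrows A V (Cod A c)"
      using f g t by simp_all
    then obtain r where r0: "r \<in> arrows A V (Cod A c)" and r_eq: "f = c \<cdot> (j2 \<cdot> g) \<boxplus> r"
      by (rule difference_exists)
    then have r: "r \<in> Arr A" "Dom A r = V" "Cod A r = (Cod A c)"
      by simp_all
    have "v \<cdot> f \<boxplus> v \<cdot> r = v \<cdot> f"
      using g f r(1-3) t eqs arg_cong[OF r_eq, of "\<lambda>z. v \<cdot> z"] by simp
    then have "v \<cdot> r = Zero A V (Cod A v)"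
      by (rule Plus_cancel_Zero) (use f r(1-3) t in auto)
    then obtain h where h: "h \<in> Arr A" "Dom A h = V" "Cod A h = Dom A u" "u \<cdot> h = r"
      using kernel_factor[OF conflationD(7)[OF uv], of r] r(1-3) t by auto
    obtain l where l: "l \<in> Arr A" "Dom A l = V" "Cod A l = Dom A a'" "a' \<cdot> l = h"
      using conflation_lift[OF a, of h] h f t by auto
    have "c \<cdot> (j1 \<cdot> l) = u \<cdot> (a' \<cdot> l)" using l(1-3) t eqs by simp
    then have "c \<cdot> (j2 \<cdot> g \<boxplus> j1 \<cdot> l) = f" using r_eq h l g t by simp
    then show "\<exists>g\<in>arrows A V (Dom A c). c \<cdot> g = f"
      using g l t by (intro bexI[of _ "j2 \<cdot> g \<boxplus> j1 \<cdot> l"]) simp_all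
  next
    fix V f assume f: "V \<in> \<X>" "f \<in> Arr A" "Dom A f = Dom A s" "Cod A f = V"
    obtain g where g: "g \<in> Arr A" "Dom A g = Cod A a" "Cod A g = V" "g \<cdot> a = f \<cdot> i"
      using conflation_extend[OF a, of "f \<cdot> i"] f t by auto
    have "f \<in> arrows A (Cod A i) V" "g \<cdot> \<alpha> \<in> arrows A (Cod A i) V"
      using f g(1-3) t by simp_all
    then obtain r where r0: "r \<in> arrows A (Cod A i) V" and r_eq: "f = g \<cdot> \<alpha> \<boxplus> r"
      by (rule difference_exists)
    then have r: "r \<in> Arr A" "Dom A r = Cod A i" "Cod A r = V"
      by simp_all
    have "f \<cdot> i \<boxplus> r \<cdot> i = f \<cdot> i"
      using g f r(1-3) t eqs arg_cong[OF r_eq, of "\<lambda>z. z \<cdot> i"] by simp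
    then have "r \<cdot> i = Zero A (Dom A i) V"
      by (rule Plus_cancel_Zero) (use f r(1-3) t in auto)
    then obtain k where k: "k \<in> Arr A" "Dom A k = Cod A p" "Cod A k = V" "k \<cdot> p = r"
      using cokernel_factor[OF ti(8), of r] r(1-3) t by auto
    obtain l where l: "l \<in> Arr A" "Dom A l = Cod A b" "Cod A l = V" "l \<cdot> b = k"
      using conflation_extend[OF b, of k] k f t by auto
    have "(g \<cdot> q1 \<boxplus> l \<cdot> q2) \<cdot> s = f"
      using r_eq Comp_triangle[OF l(4), of p] l(1-3) k g(1-3) t eqs by simp
    then show "\<exists>g\<in>arrows A (Cod A s) V. g \<cdot> s = f"
      using g(1-3) l(1-3) t by (intro bexI[of _ "g \<cdot> q1 \<boxplus> l \<cdot> q2"]) simp_all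
  qed
  then show thesis using that uv t by metis
qed

end

section \<open>Objects with complete resolutions as a largest class\<close>

lemma subset_eq_image_iff:
  "F ` X \<subseteq> Y \<Longrightarrow> {y. y \<in> Y \<and> P y} = F ` X \<longleftrightarrow> (\<forall>y\<in>Y. P y \<longleftrightarrow> (\<exists>x\<in>X. F x = y))"
  unfolding set_eq_iff mem_Collect_eq image_iff by (metis image_subset_iff)

text \<open>Dependent choice in both directions, by iterating a choice of successors and of predecessors.\<close>
lemma bi_infinite_chain:
  fixes R :: "'c \<Rightarrow> 'c \<Rightarrow> bool"
  assumes x: "x \<in> T" and right: "\<And>y. y \<in> T \<Longrightarrow> \<exists>z\<in>T. R y z"
    and left: "\<And>y. y \<in> T \<Longrightarrow> \<exists>z\<in>T. R z y"
  shows "\<exists>C :: int \<Rightarrow> 'c. C 0 = x \<and> (\<forall>n. R (C (n + 1)) (C n))"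
proof -
  obtain r where r: "\<And>y. y \<in> T \<Longrightarrow> r y \<in> T \<and> R y (r y)" using right by metis
  obtain l where l: "\<And>y. y \<in> T \<Longrightarrow> l y \<in> T \<and> R (l y) y" using left by metis
  have rT: "(r ^^ n) x \<in> T" and lT: "(l ^^ n) x \<in> T" for n
    using x r l by (induction n) auto
  define C where "C n = (if 0 \<le> n then (l ^^ nat n) x else (r ^^ nat (- n)) x)" for n :: int
  have "R (C (n + 1)) (C n)" for n
  proof (cases "0 \<le> n")
    case True
    then have "C (n + 1) = l (C n)" "C n \<in> T" by (auto simp: C_def nat_add_distrib lT)
    then show ?thesis using l by simp
  next
    case False
    then have "nat (- n) = Suc (nat (- (n + 1)))" by simp
    then have "C n = r (C (n + 1))" "C (n + 1) \<in> T"
      using False x rT by (auto simp: C_def)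
    then show ?thesis using r by simp
  qed
  then show ?thesis by (intro exI[of _ C]) (simp add: C_def)
qed

context preadditive_category
begin

lemma hom_Comp_left:
  assumes "g \<in> Arr A"
  shows "(\<lambda>f. g \<cdot> f) \<in> hom (Hom A V (Dom A g)) (Hom A V (Cod A g))"
proof (rule homI)
  have g: "g \<in> arrows A (Dom A g) (Cod A g)" using assms by simp
  fix x y assume "x \<in> carrier (Hom A V (Dom A g))" "y \<in> carrier (Hom A V (Dom A g))"
  then show "g \<cdot> x \<in> carrier (Hom A V (Cod A g))"
    and "g \<cdot> (x \<otimes>\<^bsub>Hom A V (Dom A g)\<^esub> y) = g \<cdot> x \<otimes>\<^bsub>Hom A V (Cod A g)\<^esub> g \<cdot> y"
    unfolding Hom_simps using g Comp_arrows Comp_Plus_right by blast+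
qed

lemma hom_Comp_right:
  assumes "g \<in> Arr A"
  shows "(\<lambda>f. f \<cdot> g) \<in> hom (Hom A (Cod A g) V) (Hom A (Dom A g) V)"
proof (rule homI)
  have g: "g \<in> arrows A (Dom A g) (Cod A g)" using assms by simp
  fix x y assume "x \<in> carrier (Hom A (Cod A g) V)" "y \<in> carrier (Hom A (Cod A g) V)"
  then show "x \<cdot> g \<in> carrier (Hom A (Dom A g) V)"
    and "(x \<otimes>\<^bsub>Hom A (Cod A g) V\<^esub> y) \<cdot> g = x \<cdot> g \<otimes>\<^bsub>Hom A (Dom A g) V\<^esub> y \<cdot> g"
    unfolding Hom_simps using g Comp_arrows Comp_Plus_left by blast+
qed

lemma Hom_group: "\<lbrakk>X \<in> Obj A; Y \<in> Obj A\<rbrakk> \<Longrightarrow> group (Hom A X Y)"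
  using Hom_comm_group comm_group.axioms(2) by blast

text \<open>
  That the maps are homomorphisms of groups is automatic, so exactness of a sequence of Hom groups
  amounts to the comparison of annihilated arrows with composites.
\<close>
lemma exact_seq_Hom_into_iff:
  assumes "V \<in> Obj A" "f \<in> Arr A" "g \<in> Arr A" "Cod A f = Dom A g"
  shows "exact_seq ([Hom A V (Cod A g), Hom A V (Dom A g), Hom A V (Dom A f)],
            [\<lambda>x. g \<cdot> x, \<lambda>x. f \<cdot> x]) \<longleftrightarrow>
         (\<forall>y\<in>arrows A V (Dom A g).
            g \<cdot> y = Zero A V (Cod A g) \<longleftrightarrow> (\<exists>x\<in>arrows A V (Dom A f). f \<cdot> x = y))"
proof -
  have "group_hom (Hom A V (Dom A f)) (Hom A V (Dom A g)) (\<lambda>x. f \<cdot> x)"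
    using assms hom_Comp_left[of f V] Hom_group
    by (auto simp: group_hom_def group_hom_axioms_def)
  moreover have "group (Hom A V (Cod A g))"
    using assms Hom_group by simp
  moreover have "(\<lambda>x. f \<cdot> x) ` arrows A V (Dom A f) \<subseteq> arrows A V (Dom A g)"
    using assms by auto
  ultimately show ?thesis
    using hom_Comp_left[OF assms(3), of V]
    by (simp only: exact_seq_cons_iff exact_seq_end_iff kernel_def Hom_simps
        subset_eq_image_iff simp_thms)
qed

lemma exact_seq_Hom_from_iff:
  assumes "V \<in> Obj A" "f \<in> Arr A" "g \<in> Arr A" "Cod A f = Dom A g"
  shows "exact_seq ([Hom A (Dom A f) V, Hom A (Dom A g) V, Hom A (Cod A g) V],
            [\<lambda>x. x \<cdot> f, \<lambda>x. x \<cdot> g]) \<longleftrightarrow>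
         (\<forall>y\<in>arrows A (Dom A g) V.
            y \<cdot> f = Zero A (Dom A f) V \<longleftrightarrow> (\<exists>x\<in>arrows A (Cod A g) V. x \<cdot> g = y))"
proof -
  have "group_hom (Hom A (Cod A g) V) (Hom A (Dom A g) V) (\<lambda>x. x \<cdot> g)"
    using assms hom_Comp_right[of g V] Hom_group
    by (auto simp: group_hom_def group_hom_axioms_def)
  moreover have "group (Hom A (Dom A f) V)"
    using assms Hom_group by simp
  moreover have "(\<lambda>x. x \<cdot> g) ` arrows A (Cod A g) V \<subseteq> arrows A (Dom A g) V"
    using assms by auto
  moreover have "(\<lambda>x. x \<cdot> f) \<in> hom (Hom A (Dom A g) V) (Hom A (Dom A f) V)"
    using hom_Comp_right[OF assms(2), of V] assms(4) by simp
  ultimately show ?thesis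
    by (simp only: exact_seq_cons_iff exact_seq_end_iff kernel_def Hom_simps
        subset_eq_image_iff simp_thms)
qed

end

context abelian_category
begin

text \<open>
  In an exact complex every differential is the cokernel \<open>q\<close> of the preceding differential followed
  by a monic arrow, because \<open>q\<close> has the same kernel as the differential.  That monic arrow has the
  same cokernels as the differential.
\<close>
lemma exact_complex_step:
  assumes d: "exact_complex A d" and q: "is_cokernel A (d (n + 1)) q"
  obtains m where "monic A m" "Dom A m = Cod A q" "Cod A m = Cod A (d n)" "m \<cdot> q = d n"
    "\<And>q'. is_cokernel A (d n) q' \<Longrightarrow> is_cokernel A m q'"
proof -
  have td: "d n \<in> Arr A" "d (n + 1) \<in> Arr A" "Cod A (d (n + 1)) = Dom A (d n)"
    and ex: "exact_pair A (d (n + 1)) (d n)"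
    using d unfolding exact_complex_def by auto
  obtain k q0 where q0: "is_cokernel A (d (n + 1)) q0" and k: "is_kernel A q0 k"
    and dk: "is_kernel A (d n) k"
    using ex unfolding exact_pair_def is_image_def by blast
  note t = td cokernelD[OF q] cokernelD[OF q0] kernelD[OF k] kernelD[OF dk]
  obtain e where e: "e \<in> Arr A" "Dom A e = Dom A (d (n + 1))" "Cod A e = Dom A k"
      "k \<cdot> e = d (n + 1)"
    using kernel_factor[OF k, of "d (n + 1)"] t by auto
  have dd: "d n \<cdot> d (n + 1) = Zero A (Dom A (d (n + 1))) (Cod A (d n))"
    unfolding e(4)[symmetric] using Comp_triangle[OF kernelD(5)[OF dk], of e] e(1-3) t by simp
  obtain m where m: "m \<in> Arr A" "Dom A m = Cod A q" "Cod A m = Cod A (d n)" "m \<cdot> q = d n"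
    using cokernel_factor[OF q, of "d n"] dd t by auto
  obtain w where w: "w \<in> Arr A" "Dom A w = Cod A q0" "Cod A w = Cod A q" "w \<cdot> q0 = q"
    using cokernel_factor[OF q0, of q] t by auto
  have qk: "q \<cdot> k = Zero A (Dom A k) (Cod A q)"
    unfolding w(4)[symmetric] using w(1-3) t by simp
  have mm: "monic A m"
    using monic_if_same_kernel[OF cokernelD(3)[OF q] m(1,2), of k] m(4) dk qk by simp
  have "is_cokernel A m q'" if q': "is_cokernel A (d n) q'" for q'
    unfolding cokernel_iff
  proof (intro conjI ballI impI)
    note t' = cokernelD[OF q']
    show "q' \<cdot> m = Zero A (Dom A m) (Cod A q')"
      using epic_ZeroD[OF cokernelD(3)[OF q], of "q' \<cdot> m"] m t t' by simp
    fix x assume x: "x \<in> Arr A" "Dom A x = Cod A m" "x \<cdot> m = Zero A (Dom A m) (Cod A x)"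
    have "x \<cdot> d n = Zero A (Dom A (d n)) (Cod A x)"
      using Comp_triangle[OF x(3), of q] x(1,2) m t by simp
    then show "\<exists>u\<in>arrows A (Cod A q') (Cod A x). u \<cdot> q' = x"
      using q' x m(3) unfolding cokernel_iff by auto
  qed (use m cokernelD[OF q'] in auto)
  then show thesis using that mm m by blast
qed

text \<open>
  A totally acyclic complex is cut into conflations between its syzygies.  A map \<open>f\<close> into a syzygy
  becomes, after the inclusion \<open>m\<close> into the next term, a cycle of the complex \<open>Hom(V, X)\<close>; being a
  boundary, it lifts.  Extensions are found in the same way in \<open>Hom(X, V)\<close>.
\<close>
lemma totally_acyclic_conflation:
  assumes d: "totally_acyclic A \<X> d"
    and q: "is_cokernel A (d (n + 1)) q" and q': "is_cokernel A (d n) q'"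
  obtains k where "conflation A \<X> k q'" "Dom A k = Cod A q" "Cod A k \<in> \<X>"
proof -
  have ex: "exact_complex A d" using d by (simp add: totally_acyclic_def)
  have td: "d j \<in> Arr A" "Cod A (d (j + 1)) = Dom A (d j)" for j
    using ex unfolding exact_complex_def by auto
  obtain k where k: "monic A k" "Dom A k = Cod A q" "Cod A k = Cod A (d n)" "k \<cdot> q = d n"
    and coker: "is_cokernel A k q'"
    using exact_complex_step[OF ex q] q' by metis
  have codn: "Cod A (d n) = Dom A (d (n - 1))" using td(2)[of "n - 1"] by simp
  have cokd: "is_cokernel A (d (n - 1 + 1)) q'" using q' by simp
  obtain q'' where q'': "is_cokernel A (d (n - 1)) q''" using has_cokernels td by blast
  have cokd2: "is_cokernel A (d (n - 2 + 1)) q''" using q'' by simp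
  obtain m where m: "monic A m" "Dom A m = Cod A q'" "Cod A m = Cod A (d (n - 1))"
      "m \<cdot> q' = d (n - 1)" and cokm: "is_cokernel A m q''"
    using exact_complex_step[OF ex cokd] q'' by metis
  obtain m' where m': "m' \<in> Arr A" "Dom A m' = Cod A q''" "Cod A m' = Cod A (d (n - 2))"
      "m' \<cdot> q'' = d (n - 2)"
    using exact_complex_step[OF ex cokd2] unfolding monic_def by metis
  have tkm: "k \<in> Arr A" "m \<in> Arr A" using k m by (auto simp: monic_def)
  note t = cokernelD[OF q] cokernelD[OF q'] cokernelD[OF q''] td(1)
  have "conflation A \<X> k q'"
  proof (rule conflationI[OF k(1) coker])
    fix V f assume f: "V \<in> \<X>" "f \<in> Arr A" "Dom A f = V" "Cod A f = Cod A q'"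
    have oV: "V \<in> Obj A" using f by auto
    have codn2: "Cod A (d (n - 1)) = Dom A (d (n - 2))" using td(2)[of "n - 2"] by simp
    have "Hom_into_exact A V d" using d f(1) by (simp add: totally_acyclic_def)
    from this[unfolded Hom_into_exact_def, rule_format, of "n - 2"]
    have "exact_seq ([Hom A V (Cod A (d (n - 2))), Hom A V (Dom A (d (n - 2))),
        Hom A V (Dom A (d (n - 1)))], [\<lambda>f. d (n - 2) \<cdot> f, \<lambda>f. d (n - 1) \<cdot> f])"
      by simp
    then have exV: "\<forall>y\<in>arrows A V (Dom A (d (n - 2))).
        d (n - 2) \<cdot> y = Zero A V (Cod A (d (n - 2))) \<longleftrightarrow>
        (\<exists>x\<in>arrows A V (Dom A (d (n - 1))). d (n - 1) \<cdot> x = y)"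
      by (simp only: exact_seq_Hom_into_iff[OF oV td(1) td(1) codn2])
    have "d (n - 2) \<cdot> (m \<cdot> f) = m' \<cdot> ((q'' \<cdot> m) \<cdot> f)"
      unfolding m'(4)[symmetric] using m(2,3) m'(1-3) f tkm t by simp
    also have "\<dots> = Zero A V (Cod A (d (n - 2)))"
      unfolding cokernelD(5)[OF cokm] using oV m(2,3) m'(1-3) f tkm t by simp
    finally have "d (n - 2) \<cdot> (m \<cdot> f) = Zero A V (Cod A (d (n - 2)))" .
    moreover have "m \<cdot> f \<in> arrows A V (Dom A (d (n - 2)))" using m(2,3) f tkm codn2 by simp
    ultimately obtain x where x: "x \<in> arrows A V (Dom A (d (n - 1)))" "d (n - 1) \<cdot> x = m \<cdot> f"
      using exV by blast
    have "q' \<cdot> x = f"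
      using monicD[OF m(1), of "q' \<cdot> x" f] Comp_triangle[OF m(4), of x] x f m tkm t codn by simp
    then show "\<exists>g\<in>arrows A V (Dom A q'). q' \<cdot> g = f"
      using x(1) t codn by (intro bexI[of _ x]) simp_all
  next
    fix V f assume f: "V \<in> \<X>" "f \<in> Arr A" "Dom A f = Dom A k" "Cod A f = V"
    have oV: "V \<in> Obj A" using f by auto
    have "Hom_from_exact A d V" using d f(1) by (simp add: totally_acyclic_def)
    from this[unfolded Hom_from_exact_def, rule_format, of n]
    have exV: "\<forall>y\<in>arrows A (Dom A (d n)) V.
        y \<cdot> d (n + 1) = Zero A (Dom A (d (n + 1))) V \<longleftrightarrow>
        (\<exists>x\<in>arrows A (Cod A (d n)) V. x \<cdot> d n = y)"
      by (simp only: exact_seq_Hom_from_iff[OF oV td(1) td(1) td(2)])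
    have "(f \<cdot> q) \<cdot> d (n + 1) = Zero A (Dom A (d (n + 1))) V"
      using f k t td(2)[of n] by simp
    moreover have "f \<cdot> q \<in> arrows A (Dom A (d n)) V" using f k t td(2)[of n] by simp
    ultimately obtain x where x: "x \<in> arrows A (Cod A (d n)) V" "x \<cdot> d n = f \<cdot> q"
      using exV by blast
    have "x \<cdot> k = f"
      using epicD[OF cokernelD(3)[OF q], of "x \<cdot> k" f] x f k tkm t by simp
    then show "\<exists>g\<in>arrows A (Cod A k) V. g \<cdot> k = f"
      using x(1) k by (intro bexI[of _ x]) simp_all
  qed
  moreover have "Cod A k \<in> \<X>" using d k(3) codn by (simp add: totally_acyclic_def)
  ultimately show thesis using that k by blast
qed

lemma totally_acyclic_shift:
  assumes "totally_acyclic A \<X> d"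
  shows "totally_acyclic A \<X> (\<lambda>n. d (n + k))"
proof -
  have shift: "n + 1 + k = (n + k) + 1" for n by simp
  show ?thesis
    using assms unfolding totally_acyclic_def exact_complex_def Hom_into_exact_def
      Hom_from_exact_def shift by blast
qed

lemma isomorphic_refl: "X \<in> Obj A \<Longrightarrow> isomorphic A X X"
  unfolding isomorphic_def by (intro bexI[of _ "Ident A X"]) auto

lemma Cod_cokernel_in_Gorenstein:
  assumes "totally_acyclic A \<X> d" "is_cokernel A (d n) q"
  shows "Cod A q \<in> Gorenstein A \<X>"
proof -
  have "totally_acyclic A \<X> (\<lambda>j. d (j + (n - 1)))" by (rule totally_acyclic_shift[OF assms(1)])
  moreover have "is_cokernel A (d (1 + (n - 1))) q" using assms(2) by simp
  moreover have "Cod A q \<in> Obj A" using cokernelD[OF assms(2)] by simp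
  ultimately show ?thesis using isomorphic_refl unfolding Gorenstein_def by blast
qed

lemma conflation_iso_left:
  assumes ip: "conflation A \<X> i p"
    and iso: "\<phi> \<in> arrows A M (Dom A i)" "\<psi> \<in> arrows A (Dom A i) M"
      "\<psi> \<cdot> \<phi> = Ident A M" "\<phi> \<cdot> \<psi> = Ident A (Dom A i)"
  shows "conflation A \<X> (i \<cdot> \<phi>) p"
proof -
  note t = conflationD(1-4)[OF ip] iso(1,2)
  have Mo: "M \<in> Obj A" using iso by auto
  have mphi: "monic A \<phi>"
  proof (rule monicI)
    fix x assume x: "x \<in> Arr A" "Cod A x = Dom A \<phi>" "\<phi> \<cdot> x = Zero A (Dom A x) (Cod A \<phi>)"
    then have "Ident A M \<cdot> x = Zero A (Dom A x) M"
      unfolding iso(3)[symmetric] using t by simp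
    then show "x = Zero A (Dom A x) (Dom A \<phi>)" using x t by simp
  qed (use t in simp)
  have mi: "monic A (i \<cdot> \<phi>)" using monic_Comp[OF mphi conflationD(5)[OF ip]] t by simp
  have via_psi: "x \<cdot> i = (x \<cdot> (i \<cdot> \<phi>)) \<cdot> \<psi>" if "x \<in> Arr A" "Dom A x = Cod A i" for x
    using that t iso(4) by simp
  have "is_cokernel A (i \<cdot> \<phi>) p"
    unfolding cokernel_iff
  proof (intro conjI ballI impI)
    show "p \<cdot> (i \<cdot> \<phi>) = Zero A (Dom A (i \<cdot> \<phi>)) (Cod A p)"
      using Comp_triangle[OF t(4), of \<phi>] t(1-3,5,6) by simp
    fix x assume x: "x \<in> Arr A" "Dom A x = Cod A (i \<cdot> \<phi>)"
      "x \<cdot> (i \<cdot> \<phi>) = Zero A (Dom A (i \<cdot> \<phi>)) (Cod A x)"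
    have "x \<cdot> i = Zero A (Dom A i) (Cod A x)"
      using via_psi[of x] x t(1-3,5,6) by simp
    then show "\<exists>u\<in>arrows A (Cod A p) (Cod A x). u \<cdot> p = x"
      using conflationD(8)[OF ip] x t(1-3,5,6) unfolding cokernel_iff by auto
  qed (use t conflationD(6)[OF ip] in auto)
  then show ?thesis
  proof (rule conflationI[OF mi])
    fix V f assume f: "V \<in> \<X>" "f \<in> Arr A" "Dom A f = V" "Cod A f = Cod A p"
    then show "\<exists>g\<in>arrows A V (Dom A p). p \<cdot> g = f"
      using ip unfolding conflation_def by auto
  next
    fix V f assume f: "V \<in> \<X>" "f \<in> Arr A" "Dom A f = Dom A (i \<cdot> \<phi>)" "Cod A f = V"
    have tf: "f \<cdot> \<psi> \<in> Arr A" "Dom A (f \<cdot> \<psi>) = Dom A i" "Cod A (f \<cdot> \<psi>) = V"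
      using f t(1-3,5,6) by auto
    obtain g where g: "g \<in> Arr A" "Dom A g = Cod A i" "Cod A g = V" "g \<cdot> i = f \<cdot> \<psi>"
      using conflation_extend[OF ip, of "f \<cdot> \<psi>"] tf f(1) by metis
    have "g \<cdot> (i \<cdot> \<phi>) = f \<cdot> (\<psi> \<cdot> \<phi>)"
      using Comp_square[OF g(4), of \<phi>] g(1-3) f t(1-3,5,6) by simp
    also have "\<dots> = f" using iso(3) f t(1-3,5,6) by simp
    finally show "\<exists>g\<in>arrows A (Cod A (i \<cdot> \<phi>)) V. g \<cdot> (i \<cdot> \<phi>) = f"
      using g(1-3) t(1-3,5,6) by (intro bexI[of _ g]) simp_all
  qed
qed

lemma conflation_iso_right:
  assumes ip: "conflation A \<X> i p"
    and iso: "\<phi> \<in> arrows A (Cod A p) M" "\<psi> \<in> arrows A M (Cod A p)"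
      "\<phi> \<cdot> \<psi> = Ident A M" "\<psi> \<cdot> \<phi> = Ident A (Cod A p)"
  shows "conflation A \<X> i (\<phi> \<cdot> p)"
  using abelian_category.conflation_iso_left[OF abelian_op, of \<X> p i \<phi> M \<psi>] assms
  by (simp add: op_conflation)

lemma Gorenstein_subset_Obj: "Gorenstein A \<X> \<subseteq> Obj A"
  by (auto simp: Gorenstein_def)

text \<open>
  Together with the coinduction rule below, this characterizes \<open>\<G>(\<X>)\<close> as the largest class of
  objects with conflations to both sides, and hides the complexes from the rest of the proof.
\<close>
lemma Gorenstein_conflations:
  assumes "M \<in> Gorenstein A \<X>"
  shows "\<exists>i p. conflation A \<X> i p \<and> Dom A i = M \<and> Cod A i \<in> \<X> \<and> Cod A p \<in> Gorenstein A \<X>"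
    and "\<exists>i p. conflation A \<X> i p \<and> Dom A i \<in> Gorenstein A \<X> \<and> Cod A i \<in> \<X> \<and> Cod A p = M"
proof -
  obtain d q where d: "totally_acyclic A \<X> d" and q: "is_cokernel A (d 1) q"
    and iso: "isomorphic A M (Cod A q)"
    using assms unfolding Gorenstein_def by blast
  obtain \<phi> \<psi> where \<phi>: "\<phi> \<in> arrows A M (Cod A q)" "\<psi> \<in> arrows A (Cod A q) M"
    "\<psi> \<cdot> \<phi> = Ident A M" "\<phi> \<cdot> \<psi> = Ident A (Cod A q)"
    using iso unfolding isomorphic_def by blast
  have td: "d n \<in> Arr A" for n
    using d unfolding totally_acyclic_def exact_complex_def by blast
  obtain q0 where q0: "is_cokernel A (d 0) q0" using has_cokernels td by blast
  obtain q2 where q2: "is_cokernel A (d 2) q2" using has_cokernels td by blast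
  obtain k where k: "conflation A \<X> k q0" "Dom A k = Cod A q" "Cod A k \<in> \<X>"
    using totally_acyclic_conflation[OF d, of 0 q q0] q q0 by auto
  have "conflation A \<X> (k \<cdot> \<phi>) q0"
    using conflation_iso_left[OF k(1), of \<phi> M \<psi>] \<phi> k(2) by simp
  moreover have "Dom A (k \<cdot> \<phi>) = M" "Cod A (k \<cdot> \<phi>) = Cod A k"
    using \<phi>(1) k(2) conflationD(1)[OF k(1)] by auto
  ultimately show "\<exists>i p. conflation A \<X> i p \<and> Dom A i = M \<and> Cod A i \<in> \<X> \<and>
      Cod A p \<in> Gorenstein A \<X>"
    using k(3) Cod_cokernel_in_Gorenstein[OF d q0] by metis
  obtain k' where k': "conflation A \<X> k' q" "Dom A k' = Cod A q2" "Cod A k' \<in> \<X>"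
    using totally_acyclic_conflation[OF d, of 1 q2 q] q q2 by auto
  have "conflation A \<X> k' (\<psi> \<cdot> q)"
    using conflation_iso_right[OF k'(1), of \<psi> M \<phi>] \<phi> by simp
  moreover have "Cod A (\<psi> \<cdot> q) = M"
    using \<phi>(2) conflationD(2)[OF k'(1)] by auto
  ultimately show "\<exists>i p. conflation A \<X> i p \<and> Dom A i \<in> Gorenstein A \<X> \<and> Cod A i \<in> \<X> \<and>
      Cod A p = M"
    using k'(2,3) Cod_cokernel_in_Gorenstein[OF d q2] by metis
qed

lemma cokernel_Comp_epic:
  assumes q: "is_cokernel A k q" and e: "epic A e" "Cod A e = Dom A k"
  shows "is_cokernel A (k \<cdot> e) q"
  unfolding cokernel_iff
proof (intro conjI ballI impI)
  have te: "e \<in> Arr A" using e(1) by (simp add: epic_def)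
  note t = cokernelD[OF q] te e(2)
  show "k \<cdot> e \<in> Arr A" "epic A q" "Dom A q = Cod A (k \<cdot> e)" using t by auto
  show "q \<cdot> (k \<cdot> e) = Zero A (Dom A (k \<cdot> e)) (Cod A q)"
    using Comp_triangle[OF cokernelD(5)[OF q], of e] t by simp
  fix x assume x: "x \<in> Arr A" "Dom A x = Cod A (k \<cdot> e)"
    "x \<cdot> (k \<cdot> e) = Zero A (Dom A (k \<cdot> e)) (Cod A x)"
  then have "x \<cdot> k = Zero A (Dom A k) (Cod A x)"
    using epic_ZeroD[OF e(1), of "x \<cdot> k"] t by simp
  then show "\<exists>u\<in>arrows A (Cod A q) (Cod A x). u \<cdot> q = x"
    using q x t unfolding cokernel_iff by auto
qed

lemma kernel_Comp_monic:
  "\<lbrakk>is_kernel A f k; monic A m; Cod A f = Dom A m\<rbrakk> \<Longrightarrow> is_kernel A (m \<cdot> f) k"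
  using abelian_category.cokernel_Comp_epic[OF abelian_op, of f k m]
  by (simp add: op_cokernel op_epic)

text \<open>
  Conversely, a sequence of conflations with matching ends is spliced to a complex.  A cycle in
  \<open>Hom(V, X)\<close> comes from a map into a syzygy, which lifts because \<open>V\<close> is relatively projective;
  dually for \<open>Hom(X, V)\<close>.
\<close>
lemma spliced_totally_acyclic:
  assumes obj: "\<X> \<subseteq> Obj A" and conf: "\<And>n. conflation A \<X> (k n) (e n)"
    and match: "\<And>n. Dom A (k n) = Cod A (e (n + 1))" and mid: "\<And>n. Cod A (k n) \<in> \<X>"
  shows "totally_acyclic A \<X> (\<lambda>n. k (n - 1) \<cdot> e n)"
proof -
  note t = conflationD(1-4)[OF conf]
  have match': "Dom A (k (n - 1)) = Cod A (e n)" for n using match[of "n - 1"] by simp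
  let ?d = "\<lambda>n. k (n - 1) \<cdot> e n"
  have td: "?d n \<in> Arr A" "Dom A (?d n) = Dom A (e n)" "Cod A (?d n) = Cod A (k (n - 1))" for n
    using t match' by auto
  have ds: "k (n + 1 - 1) \<cdot> e (n + 1) = k n \<cdot> e (n + 1)" for n by simp
  have "exact_pair A (?d (n + 1)) (?d n)" for n
    unfolding exact_pair_def is_image_def ds
    using cokernel_Comp_epic[OF conflationD(8)[OF conf[of n]] conflationD(6)[OF conf[of "n + 1"]]]
      kernel_Comp_monic[OF conflationD(7)[OF conf[of n]] conflationD(5)[OF conf[of "n - 1"]]]
      conflationD(7)[OF conf[of n]] match match' by metis
  then have "exact_complex A ?d"
    unfolding exact_complex_def using td by (simp add: t match match')
  moreover have cd: "Cod A (?d (n + 1)) = Dom A (?d n)" for n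
    using td(2,3)[of n] by (simp add: t match match')
  moreover have dd: "?d n \<cdot> ?d (n + 1) = Zero A (Dom A (?d (n + 1))) (Cod A (?d n))" for n
    using Comp_triangle[OF t(4)[of n], of "e (n + 1)"] by (simp add: t match match')
  moreover have "Dom A (?d n) \<in> \<X>" for n using td t mid by metis
  moreover have "Hom_into_exact A V ?d" if V: "V \<in> \<X>" for V
    unfolding Hom_into_exact_def
  proof
    fix n
    have oV: "V \<in> Obj A" using V obj by blast
    have "\<exists>x\<in>arrows A V (Dom A (?d (n + 1))). ?d (n + 1) \<cdot> x = y"
      if y: "y \<in> arrows A V (Dom A (?d n))" "?d n \<cdot> y = Zero A V (Cod A (?d n))" for y
    proof -
      have ty: "y \<in> Arr A" "Dom A y = V" "Cod A y = Dom A (e n)" using y(1) td(2) by auto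
      have "e n \<cdot> y = Zero A V (Cod A (e n))"
        using monic_ZeroD[OF conflationD(5)[OF conf[of "n - 1"]], of "e n \<cdot> y"] y(2) ty
        by (simp add: t match')
      then obtain z where z: "z \<in> Arr A" "Dom A z = V" "Cod A z = Dom A (k n)" "k n \<cdot> z = y"
        using kernel_factor[OF conflationD(7)[OF conf[of n]], of y] ty by metis
      obtain x where x: "x \<in> Arr A" "Dom A x = V" "Cod A x = Dom A (e (n + 1))"
          "e (n + 1) \<cdot> x = z"
        using conflation_lift[OF conf[of "n + 1"], of z] z(1-3) V match by metis
      have "?d (n + 1) \<cdot> x = y" using x z(4) by (simp add: t match)
      then show ?thesis using x(1-3) td(2)[of "n + 1"] by (intro bexI[of _ x]) simp_all
    qed
    moreover have "?d n \<cdot> (?d (n + 1) \<cdot> x) = Zero A V (Cod A (?d n))"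
      if x: "x \<in> arrows A V (Dom A (?d (n + 1)))" for x
      using x Comp_triangle[OF dd[of n], of x] td(1)[of n] td(1)[of "n + 1"] cd[of n] by simp
    ultimately show "exact_seq ([Hom A V (Cod A (?d n)), Hom A V (Dom A (?d n)),
        Hom A V (Dom A (?d (n + 1)))], [\<lambda>f. ?d n \<cdot> f, \<lambda>f. ?d (n + 1) \<cdot> f])"
      unfolding exact_seq_Hom_into_iff[OF oV td(1) td(1) cd] by blast
  qed
  moreover have "Hom_from_exact A ?d V" if V: "V \<in> \<X>" for V
    unfolding Hom_from_exact_def
  proof
    fix n
    have oV: "V \<in> Obj A" using V obj by blast
    have "\<exists>x\<in>arrows A (Cod A (?d n)) V. x \<cdot> ?d n = y"
      if y: "y \<in> arrows A (Dom A (?d n)) V"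
        "y \<cdot> ?d (n + 1) = Zero A (Dom A (?d (n + 1))) V" for y
    proof -
      have ty: "y \<in> Arr A" "Cod A y = V" "Dom A y = Dom A (e n)" using y(1) td(2) by auto
      have "y \<cdot> k n = Zero A (Dom A (k n)) V"
        using epic_ZeroD[OF conflationD(6)[OF conf[of "n + 1"]], of "y \<cdot> k n"] y(2) ty
        by (simp add: t match)
      then obtain z where z: "z \<in> Arr A" "Dom A z = Cod A (e n)" "Cod A z = V" "z \<cdot> e n = y"
        using cokernel_factor[OF conflationD(8)[OF conf[of n]], of y] ty t(3)[of n] by metis
      obtain x where x: "x \<in> Arr A" "Dom A x = Cod A (k (n - 1))" "Cod A x = V"
          "x \<cdot> k (n - 1) = z"
        using conflation_extend[OF conf[of "n - 1"], of z] z(1-3) V match' by metis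
      have "x \<cdot> ?d n = y"
        using x(1-3) z(4) Comp_triangle[OF x(4), of "e n"] by (simp add: t match')
      then show ?thesis using x(1-3) td(3)[of n] by (intro bexI[of _ x]) simp_all
    qed
    moreover have "(x \<cdot> ?d n) \<cdot> ?d (n + 1) = Zero A (Dom A (?d (n + 1))) V"
      if x: "x \<in> arrows A (Cod A (?d n)) V" for x
    proof -
      have "(x \<cdot> ?d n) \<cdot> ?d (n + 1) = x \<cdot> (?d n \<cdot> ?d (n + 1))"
        using x td(1)[of n] td(1)[of "n + 1"] cd[of n] by (intro Comp_assoc_typed) simp_all
      then show ?thesis
        unfolding dd using x td(1)[of "n + 1"] by simp
    qed
    ultimately show "exact_seq ([Hom A (Dom A (?d (n + 1))) V, Hom A (Dom A (?d n)) V,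
        Hom A (Cod A (?d n)) V], [\<lambda>f. f \<cdot> ?d (n + 1), \<lambda>f. f \<cdot> ?d n])"
      unfolding exact_seq_Hom_from_iff[OF oV td(1) td(1) cd] by blast
  qed
  ultimately show ?thesis unfolding totally_acyclic_def by blast
qed

text \<open>
  The two assumptions let a sequence of conflations be continued for ever in both directions
  starting from \<open>M\<close>; spliced together they form a complete resolution of \<open>M\<close>.
\<close>
lemma Gorenstein_coinduct:
  assumes obj: "\<X> \<subseteq> Obj A" and M: "M \<in> T"
    and right: "\<And>N. N \<in> T \<Longrightarrow>
      \<exists>i p. conflation A \<X> i p \<and> Dom A i = N \<and> Cod A i \<in> \<X> \<and> Cod A p \<in> T"
    and left: "\<And>N. N \<in> T \<Longrightarrow>
      \<exists>i p. conflation A \<X> i p \<and> Dom A i \<in> T \<and> Cod A i \<in> \<X> \<and> Cod A p = N"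
  shows "M \<in> Gorenstein A \<X>"
proof -
  define R where "R N N' \<longleftrightarrow>
    (\<exists>i p. conflation A \<X> i p \<and> Dom A i = N \<and> Cod A i \<in> \<X> \<and> Cod A p = N')" for N N'
  have "\<exists>C. C 0 = M \<and> (\<forall>n::int. R (C (n + 1)) (C n))"
    by (rule bi_infinite_chain[OF M]) (use left right in \<open>unfold R_def, blast+\<close>)
  then obtain C where C: "C 0 = M" "\<And>n::int. R (C (n + 1)) (C n)" by blast
  then obtain k e where ke: "\<And>n. conflation A \<X> (k n) (e n)" "\<And>n. Dom A (k n) = C (n + 1)"
      "\<And>n. Cod A (k n) \<in> \<X>" "\<And>n. Cod A (e n) = C n"
    unfolding R_def by metis
  have "totally_acyclic A \<X> (\<lambda>n. k (n - 1) \<cdot> e n)"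
    by (rule spliced_totally_acyclic[OF obj ke(1)]) (simp_all add: ke)
  moreover have "is_cokernel A (k (1 - 1) \<cdot> e 1) (e 0)"
    using cokernel_Comp_epic[OF conflationD(8)[OF ke(1)[of 0]] conflationD(6)[OF ke(1)[of 1]]]
      ke(2)[of 0] ke(4)[of 1] by simp
  moreover have M_eq: "Cod A (e 0) = M" using ke(4)[of 0] C(1) by simp
  moreover have "M \<in> Obj A"
    using Cod_Obj[OF conflationD(2)[OF ke(1)[of 0]]] M_eq by simp
  ultimately show ?thesis unfolding Gorenstein_def using isomorphic_refl by blast
qed

lemma zero_object_arrow:
  assumes "zero_object A Z" "f \<in> Arr A"
  shows "Dom A f = Z \<Longrightarrow> f = Zero A Z (Cod A f)" and "Cod A f = Z \<Longrightarrow> f = Zero A (Dom A f) Z"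
proof -
  have Z: "Z \<in> Obj A" using assms(1) by (simp add: zero_object_def)
  show "f = Zero A Z (Cod A f)" if "Dom A f = Z"
  proof -
    have "\<exists>!g. g \<in> arrows A Z (Cod A f)"
      using assms(1) Cod_Obj[OF assms(2)] unfolding zero_object_def by blast
    moreover have "f \<in> arrows A Z (Cod A f)" "Zero A Z (Cod A f) \<in> arrows A Z (Cod A f)"
      using assms(2) that Z by simp_all
    ultimately show ?thesis by blast
  qed
  show "f = Zero A (Dom A f) Z" if "Cod A f = Z"
  proof -
    have "\<exists>!g. g \<in> arrows A (Dom A f) Z"
      using assms(1) Dom_Obj[OF assms(2)] unfolding zero_object_def by blast
    moreover have "f \<in> arrows A (Dom A f) Z" "Zero A (Dom A f) Z \<in> arrows A (Dom A f) Z"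
      using assms(2) that Z by simp_all
    ultimately show ?thesis by blast
  qed
qed

lemma Ident_conflation:
  assumes Z: "zero_object A Z" and M: "M \<in> Obj A"
  shows "conflation A \<X> (Ident A M) (Zero A M Z)"
proof -
  have oZ: "Z \<in> Obj A" using Z by (simp add: zero_object_def)
  note t = Ident_typed[OF M] Zero_typed[OF M oZ]
  have mono: "monic A (Ident A M)" by (rule monicI) (use M in simp_all)
  have epi: "epic A (Zero A M Z)"
  proof (rule epicI)
    show "x = Zero A (Cod A (Zero A M Z)) (Cod A x)"
      if "x \<in> Arr A" "Dom A x = Cod A (Zero A M Z)" for x
      using zero_object_arrow(1)[OF Z, of x] that t by metis
  qed (fact t)
  have "is_cokernel A (Ident A M) (Zero A M Z)"
    unfolding cokernel_iff
  proof (intro conjI ballI impI)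
    show "\<exists>u\<in>arrows A (Cod A (Zero A M Z)) (Cod A x). u \<cdot> Zero A M Z = x"
      if "x \<in> Arr A" "Dom A x = Cod A (Ident A M)"
        "x \<cdot> Ident A M = Zero A (Dom A (Ident A M)) (Cod A x)" for x
      using that M oZ by (intro bexI[of _ "Zero A Z (Cod A x)"]) simp_all
  qed (use M oZ epi in simp_all)
  with mono show ?thesis
  proof (rule conflationI)
    fix V f assume f: "f \<in> Arr A" "Dom A f = V" "Cod A f = Cod A (Zero A M Z)"
    then have "V \<in> Obj A" "Cod A f = Z" using M oZ by auto
    moreover have "Zero A V Z = f"
      using zero_object_arrow(2)[OF Z f(1)] f(2) calculation(2) by simp
    ultimately show "\<exists>g\<in>arrows A V (Dom A (Zero A M Z)). Zero A M Z \<cdot> g = f"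
      using M oZ by (intro bexI[of _ "Zero A V M"]) simp_all
  next
    show "\<exists>g\<in>arrows A (Cod A (Ident A M)) V. g \<cdot> Ident A M = f"
      if "f \<in> Arr A" "Dom A f = Dom A (Ident A M)" "Cod A f = V" for V f
      using that M by (intro bexI[of _ f]) simp_all
  qed
qed

text \<open>
  The conflations \<open>M \<rightarrow> M \<rightarrow> 0\<close> and \<open>0 \<rightarrow> M \<rightarrow> M\<close> stay inside \<open>\<X>\<close>, so coinduction applies to \<open>\<X>\<close>
  itself.
\<close>
lemma subset_Gorenstein:
  assumes Z: "zero_object A Z" "Z \<in> \<X>" and obj: "\<X> \<subseteq> Obj A"
  shows "\<X> \<subseteq> Gorenstein A \<X>"
proof
  fix M assume "M \<in> \<X>"
  then show "M \<in> Gorenstein A \<X>"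
  proof (rule Gorenstein_coinduct[OF obj])
    fix N assume N: "N \<in> \<X>"
    have o: "N \<in> Obj A" "Z \<in> Obj A" using N Z obj by auto
    show "\<exists>i p. conflation A \<X> i p \<and> Dom A i = N \<and> Cod A i \<in> \<X> \<and> Cod A p \<in> \<X>"
      using Ident_conflation[OF Z(1) o(1), of \<X>] Ident_typed[OF o(1)] Zero_typed[OF o] N Z(2)
      by metis
    have "conflation A \<X> (Zero A Z N) (Ident A N)"
      using abelian_category.Ident_conflation[OF abelian_op, of Z N \<X>] o Z(1)
      by (simp add: op_conflation op_zero_object)
    then show "\<exists>i p. conflation A \<X> i p \<and> Dom A i \<in> \<X> \<and> Cod A i \<in> \<X> \<and> Cod A p = N"
      using Ident_typed[OF o(1)] Zero_typed[OF o(2,1)] N Z(2) by metis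
  qed
qed

end

section \<open>Extension closures\<close>

text \<open>
  The cokernel of \<open>M \<rightarrow> V\<close> obtained for an object \<open>M\<close> of \<open>\<G>(\<G>(W))\<close> is only known as an extension of
  such objects, and the next cokernel as an extension of such extensions; hence the closure under
  iterated extensions.
\<close>
inductive_set extension_closure ::
  "('o, 'm, 'z) preadditive_data_scheme \<Rightarrow> 'o set \<Rightarrow> 'o set \<Rightarrow> 'o set" for A \<X> S where
  base: "M \<in> S \<Longrightarrow> M \<in> extension_closure A \<X> S"
| extension: "\<lbrakk>conflation A \<X> i p; Dom A i \<in> extension_closure A \<X> S;
    Cod A p \<in> extension_closure A \<X> S\<rbrakk> \<Longrightarrow> Cod A i \<in> extension_closure A \<X> S"

context abelian_category
begin

lemma extension_closure_subset_op: "extension_closure A \<X> S \<subseteq> extension_closure (op A) \<X> S"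
proof
  fix M assume "M \<in> extension_closure A \<X> S"
  then show "M \<in> extension_closure (op A) \<X> S"
  proof induction
    case (extension i p)
    then show ?case
      using extension_closure.extension[of "op A" \<X> p i S] conflationD(3)[OF extension.hyps(1)]
      by (simp add: op_conflation)
  qed (rule extension_closure.base)
qed

lemma op_extension_closure: "extension_closure (op A) \<X> S = extension_closure A \<X> S"
  using extension_closure_subset_op[of \<X> S]
    abelian_category.extension_closure_subset_op[OF abelian_op, of \<X> S] by simp

text \<open>
  One step of a coresolution by \<open>\<X>\<close> that does not leave the closure.  Generators need two
  conflations, an embedding into some object and an embedding of that object into \<open>\<X>\<close>; extensions
  are handled by the horseshoe lemma.
\<close>
lemma extension_closure_embedding:
  assumes sums: "\<And>V V'. \<lbrakk>V \<in> \<X>; V' \<in> \<X>\<rbrakk> \<Longrightarrow> \<exists>S\<in>\<X>. direct_sum A V V' S"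
    and S: "\<And>M. M \<in> S \<Longrightarrow> \<exists>i p j q. conflation A \<X> i p \<and> conflation A \<X> j q \<and> Dom A i = M \<and>
      Dom A j = Cod A i \<and> Cod A j \<in> \<X> \<and> Cod A p \<in> S \<and> Cod A q \<in> S"
    and M: "M \<in> extension_closure A \<X> S"
  shows "\<exists>i p. conflation A \<X> i p \<and> Dom A i = M \<and> Cod A i \<in> \<X> \<and>
      Cod A p \<in> extension_closure A \<X> S"
  using M
proof induction
  case (base M)
  then obtain i p j q where ij: "conflation A \<X> i p" "conflation A \<X> j q" "Dom A i = M"
    "Dom A j = Cod A i" "Cod A j \<in> \<X>" "Cod A p \<in> S" "Cod A q \<in> S"
    using S by blast
  obtain c u v where "conflation A \<X> (j \<cdot> i) c" "conflation A \<X> u v"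
    "Dom A u = Cod A p" "Cod A u = Cod A c" "Cod A v = Cod A q"
    using conflation_composite[OF ij(1,2,4)] by metis
  moreover have "Dom A (j \<cdot> i) = M" "Cod A (j \<cdot> i) = Cod A j"
    using ij conflationD(1)[OF ij(1)] conflationD(1)[OF ij(2)] by auto
  ultimately show ?case
    using extension_closure.extension[of A \<X> u v S] extension_closure.base ij by metis
next
  case (extension i p)
  then obtain a a' b b' where a: "conflation A \<X> a a'" "Dom A a = Dom A i" "Cod A a \<in> \<X>"
      "Cod A a' \<in> extension_closure A \<X> S"
    and b: "conflation A \<X> b b'" "Dom A b = Cod A p" "Cod A b \<in> \<X>"
      "Cod A b' \<in> extension_closure A \<X> S"
    by blast
  obtain V where V: "V \<in> \<X>" "direct_sum A (Cod A a) (Cod A b) V" using sums a b by blast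
  obtain s c u v where "conflation A \<X> s c" "Dom A s = Cod A i" "Cod A s = V"
    "conflation A \<X> u v" "Dom A u = Cod A a'" "Cod A u = Cod A c" "Cod A v = Cod A b'"
    using horseshoe[OF extension.hyps(1) a(1) b(1) a(2) b(2) a(3) b(3) V(2)] by metis
  then show ?case
    using extension_closure.extension[of A \<X> u v S] a(4) b(4) V(1) by metis
qed

text \<open>
  Coinduction with the extension closure of \<open>\<G>(\<G>(W))\<close>.  Conflations relative to \<open>\<G>(W)\<close> are
  conflations relative to \<open>W\<close>, and both ends of the auxiliary conflations of objects of \<open>\<G>(W)\<close> stay
  in \<open>\<G>(\<G>(W))\<close>, because \<open>W \<subseteq> \<G>(W) \<subseteq> \<G>(\<G>(W))\<close>.
\<close>
lemma Gorenstein_Gorenstein_subset: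
  assumes W: "subcategory A W"
  shows "Gorenstein A (Gorenstein A W) \<subseteq> Gorenstein A W"
proof
  let ?G = "Gorenstein A W" and ?GG = "Gorenstein A (Gorenstein A W)"
  have obj: "W \<subseteq> Obj A" "?G \<subseteq> Obj A" using W Gorenstein_subset_Obj by (auto simp: subcategory_def)
  obtain Z where Z: "zero_object A Z" "Z \<in> W" using W unfolding subcategory_def by blast
  have WG: "W \<subseteq> ?G" by (rule subset_Gorenstein[OF Z obj(1)])
  then have GGG: "?G \<subseteq> ?GG" using subset_Gorenstein[OF Z(1) _ obj(2)] Z(2) by blast
  have sums: "\<exists>S\<in>W. direct_sum A V V' S" if "V \<in> W" "V' \<in> W" for V V'
    using W that unfolding subcategory_def by blast
  fix M assume "M \<in> ?GG"
  then have "M \<in> extension_closure A W ?GG" by (rule extension_closure.base)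
  then show "M \<in> ?G"
  proof (rule Gorenstein_coinduct[OF obj(1)])
    fix N assume N: "N \<in> extension_closure A W ?GG"
    show "\<exists>i p. conflation A W i p \<and> Dom A i = N \<and> Cod A i \<in> W \<and>
        Cod A p \<in> extension_closure A W ?GG"
    proof (rule extension_closure_embedding[OF sums _ N])
      fix N assume "N \<in> ?GG"
      then obtain i p where i: "conflation A ?G i p" "Dom A i = N" "Cod A i \<in> ?G" "Cod A p \<in> ?GG"
        using Gorenstein_conflations(1) by blast
      obtain j q where "conflation A W j q" "Dom A j = Cod A i" "Cod A j \<in> W" "Cod A q \<in> ?G"
        using Gorenstein_conflations(1)[OF i(3)] by blast
      then show "\<exists>i p j q. conflation A W i p \<and> conflation A W j q \<and> Dom A i = N \<and>
          Dom A j = Cod A i \<and> Cod A j \<in> W \<and> Cod A p \<in> ?GG \<and> Cod A q \<in> ?GG"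
        using i conflation_mono[OF i(1) WG] GGG by blast
    qed
    have "\<exists>p i. conflation (op A) W p i \<and> Dom (op A) p = N \<and> Cod (op A) p \<in> W \<and>
        Cod (op A) i \<in> extension_closure (op A) W ?GG"
    proof (rule abelian_category.extension_closure_embedding[OF abelian_op])
      show "N \<in> extension_closure (op A) W ?GG" using N by (simp add: op_extension_closure)
      show "\<exists>S\<in>W. direct_sum (op A) V V' S" if "V \<in> W" "V' \<in> W" for V V'
        using sums that by (simp add: op_direct_sum)
      fix N assume "N \<in> ?GG"
      then obtain i p where i: "conflation A ?G i p" "Dom A i \<in> ?GG" "Cod A i \<in> ?G" "Cod A p = N"
        using Gorenstein_conflations(2) by blast
      obtain j q where j: "conflation A W j q" "Dom A j \<in> ?G" "Cod A j \<in> W" "Cod A q = Cod A i"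
        using Gorenstein_conflations(2)[OF i(3)] by blast
      show "\<exists>p i q j. conflation (op A) W p i \<and> conflation (op A) W q j \<and> Dom (op A) p = N \<and>
          Dom (op A) q = Cod (op A) p \<and> Cod (op A) q \<in> W \<and> Cod (op A) i \<in> ?GG \<and>
          Cod (op A) j \<in> ?GG"
        unfolding op_conflation op_simps
        using i j conflation_mono[OF i(1) WG] subsetD[OF GGG j(2)]
          conflationD(3)[OF i(1)] conflationD(3)[OF j(1)]
        by (intro exI[of _ p] exI[of _ i] exI[of _ q] exI[of _ j]) simp
    qed
    then obtain i p where ip: "conflation A W i p" "Cod A p = N" "Dom A p \<in> W"
        "Dom A i \<in> extension_closure A W ?GG"
      unfolding op_conflation op_simps op_extension_closure by blast
    then show "\<exists>i p. conflation A W i p \<and> Dom A i \<in> extension_closure A W ?GG \<and>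
        Cod A i \<in> W \<and> Cod A p = N"
      using conflationD(3)[OF ip(1)] by (intro exI[of _ i] exI[of _ p]) simp
  qed
qed

end

theorem corollary4p10:
  fixes A :: "('o, 'm, 'z) preadditive_data_scheme" and W :: "'o set" and n :: nat
  assumes "abelian_category A"
    and "subcategory A W"
    and "Ext_orthogonal A W W"
    and "n \<ge> 1"
  shows "Gorenstein_iter A n W = Gorenstein A W"
proof -
  interpret abelian_category A by (rule assms(1))
  obtain Z where Z: "zero_object A Z" "Z \<in> W"
    using assms(2) unfolding subcategory_def by blast
  have "W \<subseteq> Gorenstein A W"
    using subset_Gorenstein[OF Z] assms(2) by (simp add: subcategory_def)
  then have "Gorenstein A W \<subseteq> Gorenstein A (Gorenstein A W)"
    using subset_Gorenstein[OF Z(1) _ Gorenstein_subset_Obj] Z(2) by blast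
  then have stable: "Gorenstein A (Gorenstein A W) = Gorenstein A W"
    using Gorenstein_Gorenstein_subset[OF assms(2)] by blast
  show ?thesis
    using assms(4) by (induction n rule: dec_induct) (simp_all add: stable)
qed

end
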